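(* Let $g_1,\ldots,g_m\in\mathbb{R}[\mathbf{x}]$ with $\mathbf{x}=(x_1,\ldots,x_d)$, let $\mathbf{K}:=\{\mathbf{x}\in\mathbb{R}^d: g_j(\mathbf{x})\geq 0,\ j=1,\ldots,m\}$, let $d_j:=\lceil \deg(g_j)/2\rceil$ for $j=1,\ldots,m$, and let $v:=\max\{d_1,\ldots,d_m\}$. Let $n\geq v$ and let $\boldsymbol{\phi}^n=(\phi^n_{\boldsymbol{\alpha}})_{\boldsymbol{\alpha}\in\mathbb{N}^d_{2n}}$ be a real sequence, with Riesz functional $\phi^n$, such that $$\phi^n(1)=1\,;\quad \mathbf{M}_n(\boldsymbol{\phi}^n)\succeq 0\,;\quad \mathbf{M}_{n-d_j}(g_j\,\boldsymbol{\phi}^n)\succeq 0,\quad j=1,\ldots,m.$$ If $s:=\mathrm{rank}(\mathbf{M}_n(\boldsymbol{\phi}^n))\leq n-v+1$, then there is an integer $r\leq s$ such that the truncated sequence $\boldsymbol{\phi}^{\hat n}:=(\phi^n_{\boldsymbol{\alpha}})_{\boldsymbol{\alpha}\in\mathbb{N}^d_{2n-1}}$ has a representing measure supported on $r$ points of $\mathbf{K}$. In addition, if $r=s$ then the whole sequence $\boldsymbol{\phi}^n=(\phi^n_{\boldsymbol{\alpha}})_{\boldsymbol{\alpha}\in\mathbb{N}^d_{2n}}$ has a representing measure supported on $s$ points of $\mathbf{K}$.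
   Context: Notation: $\mathbb{N}^d_k:=\{\boldsymbol{\alpha}\in\mathbb{N}^d: |\boldsymbol{\alpha}|=\sum_i\alpha_i\leq k\}$; $\mathbb{R}[\mathbf{x}]_k$ is the space of real polynomials in $d$ variables of degree at most $k$. Riesz functional: for a real sequence $\boldsymbol{\phi}=(\phi_{\boldsymbol{\alpha}})_{\boldsymbol{\alpha}\in\mathbb{N}^d_{2n}}$, the Riesz functional $\phi:\mathbb{R}[\mathbf{x}]_{2n}\to\mathbb{R}$ is the linear map $p=\sum_{\boldsymbol{\alpha}}p_{\boldsymbol{\alpha}}\mathbf{x}^{\boldsymbol{\alpha}}\mapsto \phi(p)=\sum_{\boldsymbol{\alpha}}p_{\boldsymbol{\alpha}}\phi_{\boldsymbol{\alpha}}$. Moment matrix: $\mathbf{M}_n(\boldsymbol{\phi})$ is the real symmetric matrix with rows and columns indexed by $\mathbb{N}^d_n$ and entries $\mathbf{M}_n(\boldsymbol{\phi})(\boldsymbol{\alpha},\boldsymbol{\beta})=\phi_{\boldsymbol{\alpha}+\boldsymbol{\beta}}$. Localizing matrix: for $g=\sum_{\boldsymbol{\gamma}}g_{\boldsymbol{\gamma}}\mathbf{x}^{\boldsymbol{\gamma}}\in\mathbb{R}[\mathbf{x}]$, $\mathbf{M}_k(g\,\boldsymbol{\phi})$ is the real symmetric matrix with rows and columns indexed by $\mathbb{N}^d_k$ and entries $\sum_{\boldsymbol{\gamma}}g_{\boldsymbol{\gamma}}\phi_{\boldsymbol{\alpha}+\boldsymbol{\beta}+\boldsymbol{\gamma}}$.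 $\mathbf{B}\succeq0$ means that $\mathbf{B}$ is positive semidefinite. A sequence $(\phi_{\boldsymbol{\alpha}})_{\boldsymbol{\alpha}\in\mathbb{N}^d_k}$ has a representing measure if there is a (positive Borel) measure $\mu$ on $\mathbb{R}^d$ with $\phi_{\boldsymbol{\alpha}}=\int\mathbf{x}^{\boldsymbol{\alpha}}\,d\mu$ for all $\boldsymbol{\alpha}\in\mathbb{N}^d_k$. *)

theory Defs
  imports
    "HOL-Analysis.Analysis"
    "HOL-Library.Poly_Mapping"
    "HOL-Library.Function_Algebras"
begin

text \<open>The variables are indexed by a finite type \<open>'d\<close>, so that exponents are elements of
  \<open>nat ^ 'd\<close> and points are elements of \<open>real ^ 'd\<close>. A polynomial is its finitely supported
  coefficient function; \<open>Poly_Mapping\<close> provides the ring structure.\<close>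

type_synonym 'd mvpoly = "(nat ^ 'd) \<Rightarrow>\<^sub>0 real"

definition mdeg :: "nat ^ 'd::finite \<Rightarrow> nat" where
  "mdeg \<alpha> = (\<Sum>i\<in>UNIV. \<alpha> $ i)"

definition mv_monom :: "nat ^ 'd::finite \<Rightarrow> real ^ 'd \<Rightarrow> real" where
  "mv_monom \<alpha> x = (\<Prod>i\<in>UNIV. (x $ i) ^ (\<alpha> $ i))"

definition mvpoly_eval :: "'d::finite mvpoly \<Rightarrow> real ^ 'd \<Rightarrow> real" where
  "mvpoly_eval p x = (\<Sum>\<alpha>\<in>Poly_Mapping.keys p. Poly_Mapping.lookup p \<alpha> * mv_monom \<alpha> x)"

text \<open>The zero polynomial has degree 0.\<close>

definition mvpoly_degree :: "'d::finite mvpoly \<Rightarrow> nat" where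
  "mvpoly_degree p = Max (insert 0 (mdeg ` Poly_Mapping.keys p))"

definition exponents_upto :: "nat \<Rightarrow> (nat ^ 'd::finite) set" where
  "exponents_upto k = {\<alpha>. mdeg \<alpha> \<le> k}"

text \<open>Hence no sum over an exponent set collapses to the default value for infinite sets.\<close>

lemma finite_exponents_upto: "finite (exponents_upto k :: (nat ^ 'd::finite) set)"
proof -
  have "\<alpha> $ i \<le> mdeg \<alpha>" for \<alpha> :: "nat ^ 'd" and i
    unfolding mdeg_def by (rule member_le_sum) auto
  then have "vec_nth ` (exponents_upto k :: (nat ^ 'd) set) \<subseteq> {f. \<forall>i. f i \<in> {..k}}"
    unfolding exponents_upto_def by (auto intro: order_trans)
  moreover have "finite {f :: 'd \<Rightarrow> nat. \<forall>i. f i \<in> {..k}}"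
    using finite_set_of_finite_funs[of "UNIV :: 'd set" "{..k}" 0] by simp
  ultimately have "finite (vec_nth ` (exponents_upto k :: (nat ^ 'd) set))"
    by (rule finite_subset)
  then show ?thesis
    by (rule finite_imageD) (simp add: inj_on_def vec_nth_inject)
qed

text \<open>A matrix indexed by \<open>I\<close> is a function of two arguments of which only the values on
  \<open>I \<times> I\<close> matter.\<close>

definition psd_on :: "'a set \<Rightarrow> ('a \<Rightarrow> 'a \<Rightarrow> real) \<Rightarrow> bool" where
  "psd_on I B \<longleftrightarrow>
     (\<forall>i\<in>I. \<forall>j\<in>I. B i j = B j i) \<and>
     (\<forall>u :: 'a \<Rightarrow> real. (\<Sum>i\<in>I. \<Sum>j\<in>I. u i * B i j * u j) \<ge> 0)"

text \<open>The pointwise vector space of real functions, which supplies the notion of dimension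
  for the column space.\<close>

interpretation fun_vs: vector_space "\<lambda>(c :: real) (f :: 'a \<Rightarrow> real) i. c * f i"
  by unfold_locales (auto simp: fun_eq_iff algebra_simps)

definition rank_on :: "'a set \<Rightarrow> ('a \<Rightarrow> 'a \<Rightarrow> real) \<Rightarrow> nat" where
  "rank_on I B = fun_vs.dim ((\<lambda>j i. if i \<in> I then B i j else 0) ` I)"

text \<open>A sequence indexed by the exponents of degree at most \<open>k\<close> is a function on all exponents
  of which only the values at those exponents are used.\<close>

definition riesz :: "(nat ^ 'd::finite \<Rightarrow> real) \<Rightarrow> 'd mvpoly \<Rightarrow> real" where
  "riesz \<phi> p = (\<Sum>\<alpha>\<in>Poly_Mapping.keys p. Poly_Mapping.lookup p \<alpha> * \<phi> \<alpha>)"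

definition moment_matrix ::
    "(nat ^ 'd::finite \<Rightarrow> real) \<Rightarrow> nat ^ 'd \<Rightarrow> nat ^ 'd \<Rightarrow> real" where
  "moment_matrix \<phi> \<alpha> \<beta> = \<phi> (\<alpha> + \<beta>)"

definition localizing_matrix ::
    "'d::finite mvpoly \<Rightarrow> (nat ^ 'd \<Rightarrow> real) \<Rightarrow> nat ^ 'd \<Rightarrow> nat ^ 'd \<Rightarrow> real" where
  "localizing_matrix g \<phi> \<alpha> \<beta> =
     (\<Sum>\<gamma>\<in>Poly_Mapping.keys g. Poly_Mapping.lookup g \<gamma> * \<phi> (\<alpha> + \<beta> + \<gamma>))"

definition representing_measure ::
    "(nat ^ 'd::finite) set \<Rightarrow> (nat ^ 'd \<Rightarrow> real) \<Rightarrow> (real ^ 'd) measure \<Rightarrow> bool" where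
  "representing_measure A \<phi> \<mu> \<longleftrightarrow>
     sets \<mu> = sets borel \<and>
     (\<forall>\<alpha>\<in>A. integrable \<mu> (mv_monom \<alpha>) \<and> \<phi> \<alpha> = integral\<^sup>L \<mu> (mv_monom \<alpha>))"

text \<open>The support consists of exactly \<open>r\<close> points: each of them has positive mass.\<close>

definition supported_on_points ::
    "(real ^ 'd::finite) measure \<Rightarrow> nat \<Rightarrow> (real ^ 'd) set \<Rightarrow> bool" where
  "supported_on_points \<mu> r K \<longleftrightarrow>
     (\<exists>S. finite S \<and> card S = r \<and> S \<subseteq> K \<and>
          emeasure \<mu> (- S) = 0 \<and> (\<forall>x\<in>S. emeasure \<mu> {x} > 0))"

end

theory Submission
  imports Defs "HOL-Computational_Algebra.Fundamental_Theorem_Algebra"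
begin

text \<open>The columns of the moment matrix carry the inner product induced by \<open>p, q \<mapsto> \<phi> (p q)\<close>. On the
  span \<open>W\<close> of the columns of degree less than \<open>n\<close>, multiplication by a variable followed by orthogonal
  projection is a symmetric operator. The bound on the rank limits the growth of the spans of the columns
  of degree less than \<open>k\<close> so much that these operators commute. Their joint
  eigenvalues are the atoms, and the decomposition of the class of the constant 1 into joint
  eigenvectors gives the weights; this is a multivariate Gauss quadrature, exact up to degree
  \<open>2 n - 1\<close>, and up to degree \<open>2 n\<close> if \<open>W\<close> is the whole column space.\<close>

section \<open>Commuting symmetric operators\<close>

text \<open>Symmetry of the projected operators is automatic; commutation is the obstacle, because
  the two orders of multiplication may be projected differently. On columns of degree less than
  \<open>n - 1\<close> a single multiplication stays in \<open>W\<close>, so only the columns of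
  degree \<open>n - 1\<close> can cause trouble. The bound \<open>n - v + 1\<close> is a budget for
  the chain \<open>V 0, V 1, ..., V (n + 1)\<close> of spans of columns of degree less than the
  index, since every proper inclusion costs one dimension. Either the chain stalls early and then
  stays constant up to \<open>V n\<close>, or it uses up the budget: for \<open>v > 0\<close>,
  \<open>V (n - v + 1)\<close> is then the whole column space; for \<open>v = 0\<close>, either
  \<open>V n\<close> is, or it exceeds \<open>V (n - 1)\<close> by at most one dimension. The index
  \<open>k\<close> with \<open>V k = V n\<close> found in this way also puts the atoms into
  \<open>K\<close>: they are separated by polynomials of degree less than \<open>k\<close>, and the
  squares of these times the constraints must have degree within the range of exactness. Stalling
  propagates only up to \<open>V n\<close>; columns of degree \<open>n\<close> may still be new,
  which is why moments of degree \<open>2 n\<close> can be missed.\<close>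

context vector_space
begin

text \<open>The finite set \<open>S\<close> is there because the lemma is applied inside an
  infinite-dimensional function space.\<close>

lemma dim_strict_mono_span:
  assumes "finite S" "W \<subseteq> span S" "subspace U" "U \<subset> W"
  shows "dim U < dim W"
proof -
  obtain Bu where Bu: "Bu \<subseteq> U" "independent Bu" "U \<subseteq> span Bu" "card Bu = dim U"
    using basis_exists by blast
  obtain Bw where Bw: "Bw \<subseteq> W" "independent Bw" "W \<subseteq> span Bw" "card Bw = dim W"
    using basis_exists by blast
  obtain a where a: "a \<in> W" "a \<notin> U"
    using assms(4) by blast
  have "span Bu \<subseteq> U"
    using Bu(1) assms(3) by (rule span_minimal)
  then have "a \<notin> span Bu"
    using a by blast
  then have ind: "independent (insert a Bu)" and "a \<notin> Bu"
    using Bu(2) independent_insertI span_base by blast+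
  have "finite Bw"
    using independent_span_bound[OF assms(1) Bw(2)] Bw(1) assms(2) by blast
  moreover have "insert a Bu \<subseteq> span Bw"
    using a Bu(1) Bw(3) assms(4) by blast
  ultimately have "finite (insert a Bu)" "card (insert a Bu) \<le> card Bw"
    using independent_span_bound[OF _ ind] by auto
  then show ?thesis
    using \<open>a \<notin> Bu\<close> Bu(4) Bw(4) by simp
qed

end

section \<open>Real factors of real polynomials from complex roots\<close>

definition cpoly :: "real poly \<Rightarrow> complex \<Rightarrow> complex" where
  "cpoly p z = poly (map_poly of_real p) z"

lemma cpoly_simps [simp]:
  "cpoly 0 z = 0"
  "cpoly (pCons a p) z = of_real a + z * cpoly p z"
  by (auto simp: cpoly_def map_poly_pCons)

lemma cpoly_add [simp]: "cpoly (p + q) z = cpoly p z + cpoly q z"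
  by (induction p q rule: poly_induct2) (auto simp: algebra_simps)

lemma cpoly_smult [simp]: "cpoly (smult c p) z = of_real c * cpoly p z"
  by (induction p) (auto simp: algebra_simps)

lemma cpoly_mult [simp]: "cpoly (p * q) z = cpoly p z * cpoly q z"
  by (induction p) (auto simp: algebra_simps)

lemma cpoly_of_real: "cpoly p (of_real x) = of_real (poly p x)"
  by (induction p) auto

text \<open>A non-real root \<open>z\<close> yields \<open>(x - a)^2 + b^2\<close> with
  \<open>a = Re z\<close> and \<open>b = Im z\<close>: the remainder modulo this quadratic has
  degree at most 1 and vanishes at \<open>z\<close>, hence is 0. The coefficients display a sum of
  squares, which is what a symmetric operator can exploit.\<close>

lemma real_poly_linear_or_quadratic_factor:
  fixes p :: "real poly"
  assumes "degree p > 0"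
  obtains a q where "p = [:-a, 1:] * q"
  | a b q where "b \<noteq> 0" "p = [:a\<^sup>2 + b\<^sup>2, -2 * a, 1:] * q"
proof -
  let ?P = "map_poly complex_of_real p"
  have "degree ?P = degree p"
    by (rule degree_map_poly) auto
  then have "\<not> constant (poly ?P)"
    using assms by (simp add: constant_degree)
  then obtain z where "poly ?P z = 0"
    using fundamental_theorem_of_algebra by blast
  then have z: "cpoly p z = 0"
    by (simp add: cpoly_def)
  show thesis
  proof (cases "Im z = 0")
    case True
    then have "z = of_real (Re z)"
      by (simp add: complex_eq_iff)
    then have "poly p (Re z) = 0"
      using z cpoly_of_real by (metis of_real_eq_0_iff)
    then have "[:-Re z, 1:] dvd p"
      by (simp add: poly_eq_0_iff_dvd)
    then show thesis
      using that(1) by (auto elim: dvdE)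
  next
    case False
    define Q where "Q = [:(Re z)\<^sup>2 + (Im z)\<^sup>2, -2 * Re z, 1:]"
    have "Q \<noteq> 0" "degree Q = 2"
      by (auto simp: Q_def)
    then have dr: "p mod Q = 0 \<or> degree (p mod Q) < 2"
      using degree_mod_less by metis
    have "cpoly Q z = 0"
      by (simp add: Q_def complex_eq_iff power2_eq_square algebra_simps)
    moreover have "cpoly p z = cpoly (Q * (p div Q) + p mod Q) z"
      by simp
    ultimately have rz: "cpoly (p mod Q) z = 0"
      using z by (simp only: cpoly_add cpoly_mult) simp
    obtain c d where cd: "p mod Q = [:c, d:]"
    proof -
      have "degree (p mod Q) \<le> 1"
        using dr by auto
      then have "p mod Q = [:coeff (p mod Q) 0, coeff (p mod Q) 1:]"
        by (intro poly_eqI) (auto simp: coeff_pCons coeff_eq_0 split: nat.splits)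
      then show thesis
        using that by blast
    qed
    have "p mod Q = 0"
      using rz False unfolding cd by (auto simp: complex_eq_iff)
    then have "p = Q * (p div Q)"
      by (metis add.right_neutral mult_div_mod_eq)
    then show thesis
      using that(2)[OF False] unfolding Q_def by blast
  qed
qed

section \<open>Semidefinite forms and orthogonal projection\<close>

locale psd_form = vector_space scale
  for scale :: "real \<Rightarrow> 'b::ab_group_add \<Rightarrow> 'b" (infixr "\<cdot>" 75) +
  fixes B :: "'b \<Rightarrow> 'b \<Rightarrow> real"
  assumes B_add: "B (x + y) z = B x z + B y z"
    and B_scale: "B (c \<cdot> x) z = c * B x z"
    and B_sym: "B x y = B y x"
    and B_nonneg: "B x x \<ge> 0"
begin

lemma B_add_right: "B z (x + y) = B z x + B z y"
  using B_add B_sym by metis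

lemma B_scale_right: "B z (c \<cdot> x) = c * B z x"
  using B_scale B_sym by metis

lemma B_zero [simp]: "B 0 z = 0" "B z 0 = 0"
  using B_scale[of 0 0 z] B_scale_right[of z 0 0] by auto

lemma B_minus: "B (- x) z = - B x z"
  using B_add[of x "- x" z] by simp

lemma B_diff: "B (x - y) z = B x z - B y z"
  using B_add[of x "- y" z] B_minus[of y z] by simp

lemma B_diff_right: "B z (x - y) = B z x - B z y"
  using B_diff B_sym by metis

lemma B_sum: "B (\<Sum>i\<in>I. f i) z = (\<Sum>i\<in>I. B (f i) z)"
  by (induction I rule: infinite_finite_induct) (auto simp: B_add)

text \<open>Along \<open>t \<cdot> x + y\<close> the quadratic form is affine in \<open>t\<close>
  with slope \<open>2 * B x y\<close>, and nonnegativity forbids a nonzero slope; the chosen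
  \<open>t\<close> would give the value \<open>-2 - B y y\<close>.\<close>

lemma B_null:
  assumes "B x x = 0"
  shows "B x y = 0"
proof (rule ccontr)
  assume ne: "B x y \<noteq> 0"
  define t where "t = - (B y y + 1) / B x y"
  have t: "t * B x y = - (B y y + 1)"
    using ne by (simp add: t_def)
  have "0 \<le> B (t \<cdot> x + y) (t \<cdot> x + y)"
    by (rule B_nonneg)
  also have "\<dots> = 2 * (t * B x y) + B y y"
    using assms by (simp add: B_add B_add_right B_scale B_scale_right B_sym[of y x])
  also have "\<dots> = -2 - B y y"
    unfolding t by simp
  finally show False
    using B_nonneg[of y] by linarith
qed

lemma span_orthogonal:
  assumes "\<And>s. s \<in> S \<Longrightarrow> B x s = 0" "y \<in> span S"
  shows "B x y = 0"
  using assms(2) by (induction rule: span_induct_alt) (auto simp: B_add_right B_scale_right assms(1))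

lemma orthogonal_projection_exists:
  assumes "finite S"
  shows "\<exists>h\<in>span S. \<forall>y\<in>span S. B (x - h) y = 0"
  using assms
proof (induction S arbitrary: x)
  case empty
  then show ?case by auto
next
  case (insert a S)
  obtain p where p: "p \<in> span S" "\<And>y. y \<in> span S \<Longrightarrow> B (a - p) y = 0"
    using insert.IH by blast
  obtain h where h: "h \<in> span S" "\<And>y. y \<in> span S \<Longrightarrow> B (x - h) y = 0"
    using insert.IH by blast
  define a' where "a' = a - p"
  have S_sub: "span S \<subseteq> span (insert a S)"
    by (rule span_mono) auto
  have a'_in: "a' \<in> span (insert a S)"
    unfolding a'_def using p(1) S_sub by (intro span_diff) (auto intro: span_base)
  \<comment> \<open>A Gram-Schmidt step. If \<open>B a' a' = 0\<close>, division by zero makes the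
    coefficient 0; this is harmless, as \<open>a'\<close> is then orthogonal to everything.\<close>
  define c where "c = B (x - h) a' / B a' a'"
  define h' where "h' = h + c \<cdot> a'"
  have orth_S: "B (x - h') y = 0" if "y \<in> span S" for y
    using h(2)[OF that] p(2)[OF that]
    by (simp add: h'_def a'_def diff_diff_add[symmetric] B_diff B_scale)
  have orth_a': "B (x - h') a' = 0"
  proof (cases "B a' a' = 0")
    case True
    then show ?thesis
      using B_null B_sym by metis
  next
    case False
    then show ?thesis
      by (simp add: h'_def c_def B_diff B_add B_scale)
  qed
  have orth_a: "B (x - h') a = 0"
    using orth_a' orth_S[OF p(1)] by (simp add: a'_def B_diff_right)
  have "B (x - h') y = 0" if "y \<in> span (insert a S)" for y
  proof (rule span_orthogonal[OF _ that])
    fix s assume "s \<in> insert a S"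
    then show "B (x - h') s = 0"
      using orth_a orth_S[OF span_base[of s S]] by auto
  qed
  moreover have "h' \<in> span (insert a S)"
    unfolding h'_def using h(1) S_sub a'_in by (intro span_add span_scale) auto
  ultimately show ?case
    by blast
qed

section \<open>Eigenvectors from annihilating polynomials\<close>

definition eigenvector :: "('b \<Rightarrow> 'b) \<Rightarrow> 'b \<Rightarrow> bool" where
  "eigenvector T e \<longleftrightarrow> (\<exists>a. T e = a \<cdot> e)"

text \<open>This is \<open>p(T) u\<close>, evaluated by Horner's rule.\<close>

definition papply :: "('b \<Rightarrow> 'b) \<Rightarrow> real poly \<Rightarrow> 'b \<Rightarrow> 'b" where
  "papply T p u = fold_coeffs (\<lambda>a f. a \<cdot> u + T f) p 0"

context
  fixes T :: "'b \<Rightarrow> 'b"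
  assumes T_linear: "Vector_Spaces.linear scale scale T"
begin

interpretation T: Vector_Spaces.linear scale scale T
  by (rule T_linear)

lemma papply_0 [simp]: "papply T 0 u = 0"
  by (simp add: papply_def)

lemma papply_pCons [simp]: "papply T (pCons a p) u = a \<cdot> u + T (papply T p u)"
  by (cases "a = 0 \<and> p = 0") (auto simp: papply_def)

lemma papply_add [simp]: "papply T (p + q) u = papply T p u + papply T q u"
  by (induction p q rule: poly_induct2) (auto simp: T.add scale_left_distrib)

lemma papply_smult [simp]: "papply T (smult c p) u = c \<cdot> papply T p u"
  by (induction p) (auto simp: T.scale scale_right_distrib)

lemma papply_diff [simp]: "papply T (p - q) u = papply T p u - papply T q u"
  using papply_add[of "p - q" q u] by (simp add: algebra_simps)

lemma papply_monom [simp]: "papply T (monom 1 i) u = (T ^^ i) u"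
  by (induction i) (auto simp: monom_0 monom_Suc)

lemma papply_in:
  assumes "subspace U" "\<And>x. x \<in> U \<Longrightarrow> T x \<in> U" "u \<in> U"
  shows "papply T p u \<in> U"
  by (induction p) (auto intro: subspace_add subspace_scale subspace_0 assms)

text \<open>The iterates of \<open>u\<close> stay in the span of the finite set \<open>S\<close>, so
  one of them depends linearly on its predecessors; that relation is a monic polynomial.\<close>

lemma annihilating_poly_exists:
  assumes "subspace U" "\<And>x. x \<in> U \<Longrightarrow> T x \<in> U" "u \<in> U" "finite S" "U \<subseteq> span S"
  shows "\<exists>p. p \<noteq> 0 \<and> papply T p u = 0"
proof -
  define t where "t i = (T ^^ i) u" for i
  have t_in: "t i \<in> U" for i
    unfolding t_def by (induction i) (auto intro: assms)
  have "\<exists>i. t i \<in> span (t ` {..<i})"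
  proof (rule ccontr)
    assume neg: "\<not> (\<exists>i. t i \<in> span (t ` {..<i}))"
    have "independent (t ` {..<i}) \<and> card (t ` {..<i}) = i" for i
    proof (induction i)
      case 0
      then show ?case by (simp add: independent_empty)
    next
      case (Suc i)
      have "t i \<notin> t ` {..<i}"
        using neg span_base[of "t i" "t ` {..<i}"] by auto
      moreover have "independent (insert (t i) (t ` {..<i}))"
        using neg Suc by (intro independent_insertI) auto
      ultimately show ?case
        using Suc by (simp add: lessThan_Suc)
    qed
    from this[of "Suc (card S)"] independent_span_bound[OF assms(4), of "t ` {..<Suc (card S)}"]
    show False
      using t_in assms(5) by fastforce
  qed
  then obtain i where i: "t i \<in> span (t ` {..<i})"
    by blast
  have "\<exists>p. (\<forall>j\<ge>i. coeff p j = 0) \<and> t i = papply T p u"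
    using i
  proof (induction rule: span_induct_alt)
    case base
    then show ?case by (intro exI[of _ 0]) auto
  next
    case (step c x y)
    then obtain j p where j: "x = t j" "j < i" and p: "\<forall>j\<ge>i. coeff p j = 0" "y = papply T p u"
      by auto
    show ?case
      using p j by (intro exI[of _ "smult c (monom 1 j) + p"]) (auto simp: t_def)
  qed
  then obtain p where p: "\<forall>j\<ge>i. coeff p j = 0" "t i = papply T p u"
    by blast
  define q where "q = monom 1 i + smult (-1) p"
  have "coeff q i = 1"
    using p(1) by (simp add: q_def)
  then have "q \<noteq> 0"
    by auto
  moreover have "papply T q u = 0"
    unfolding q_def papply_add papply_smult papply_monom using p(2) by (simp add: t_def)
  ultimately show ?thesis
    by blast
qed

text \<open>An annihilating polynomial of \<open>u\<close> is shortened factor by factor. If a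
  linear factor cannot be dropped, the cofactor \<open>q\<close> gives the eigenvector
  \<open>q(T) u\<close>. A quadratic factor can always be dropped: with \<open>w = q(T) u\<close>,
  symmetry turns the pairing of \<open>((T - a)^2 + b^2) w\<close> with \<open>w\<close> into the
  squared length of \<open>T w - a \<cdot> w\<close> plus \<open>b\<^sup>2 * B w w\<close>, so
  \<open>w = 0\<close>.\<close>

lemma symmetric_has_eigenvector:
  assumes "subspace U" "\<And>x. x \<in> U \<Longrightarrow> T x \<in> U" "finite S" "U \<subseteq> span S"
    and def: "\<And>x. x \<in> U \<Longrightarrow> B x x = 0 \<Longrightarrow> x = 0"
    and sym: "\<And>x y. x \<in> U \<Longrightarrow> y \<in> U \<Longrightarrow> B (T x) y = B x (T y)"
    and "u \<in> U" "u \<noteq> 0"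
  shows "\<exists>a. \<exists>e\<in>U. e \<noteq> 0 \<and> T e = a \<cdot> e"
proof -
  obtain p where "p \<noteq> 0" "papply T p u = 0"
    using annihilating_poly_exists[OF assms(1,2,7,3,4)] by blast
  then show ?thesis
  proof (induction "degree p" arbitrary: p rule: less_induct)
    case less
    have "degree p > 0"
    proof (rule ccontr)
      assume "\<not> degree p > 0"
      then obtain c where "p = [:c:]"
        using degree_eq_zeroE by blast
      then show False
        using less.prems \<open>u \<noteq> 0\<close> by (auto simp: T.zero)
    qed
    then show ?case
    proof (cases p rule: real_poly_linear_or_quadratic_factor)
      case (1 a q)
      have "q \<noteq> 0"
        using 1 less.prems by auto
      then have "degree q < degree p"
        unfolding 1 by (subst degree_mult_eq) auto
      show ?thesis
      proof (cases "papply T q u = 0")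
        case True
        then show ?thesis
          using less.hyps \<open>degree q < degree p\<close> \<open>q \<noteq> 0\<close> by blast
      next
        case False
        have "T (papply T q u) = a \<cdot> papply T q u"
          using less.prems(2) unfolding 1 by (simp add: mult_pCons_left)
        then show ?thesis
          using False papply_in[OF assms(1,2) \<open>u \<in> U\<close>] by blast
      qed
    next
      case (2 a b q)
      have "q \<noteq> 0"
        using 2 less.prems by auto
      then have "degree q < degree p"
        unfolding 2 by (subst degree_mult_eq) auto
      define w where "w = papply T q u"
      have w_in: "w \<in> U" "T w \<in> U"
        using papply_in[OF assms(1,2) \<open>u \<in> U\<close>] assms(2) by (auto simp: w_def)
      have "0 = (a\<^sup>2 + b\<^sup>2) \<cdot> w + T ((-2 * a) \<cdot> w + T w)"
        using less.prems(2) unfolding 2 w_def by (simp add: mult_pCons_left T.add)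
      then have "0 = B ((a\<^sup>2 + b\<^sup>2) \<cdot> w + T ((-2 * a) \<cdot> w + T w)) w"
        by (metis B_zero(1))
      also have "\<dots> = (a\<^sup>2 + b\<^sup>2) * B w w - 2 * a * B (T w) w + B (T w) (T w)"
        using sym[of "T w" w] w_in by (simp add: T.add T.diff T.scale B_add B_diff B_scale)
      also have "\<dots> = B (T w - a \<cdot> w) (T w - a \<cdot> w) + b\<^sup>2 * B w w"
        by (simp add: B_diff B_diff_right B_scale B_scale_right B_sym[of w "T w"]
            algebra_simps power2_eq_square)
      finally have "b\<^sup>2 * B w w = 0"
        using B_nonneg[of "T w - a \<cdot> w"] B_nonneg[of w]
        by (smt (verit) mult_nonneg_nonneg zero_le_power2)
      then have "w = 0"
        using 2(1) def w_in by auto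
      then show ?thesis
        using less.hyps \<open>degree q < degree p\<close> \<open>q \<noteq> 0\<close> by (auto simp: w_def)
    qed
  qed
qed

end

section \<open>Joint diagonalisation of commuting operators\<close>

context
  fixes T :: "'i \<Rightarrow> 'b \<Rightarrow> 'b" and W S :: "'b set"
  assumes T_linear: "\<And>i. Vector_Spaces.linear scale scale (T i)"
    and fin: "finite S" "W \<subseteq> span S"
    and definite: "\<And>x. x \<in> W \<Longrightarrow> B x x = 0 \<Longrightarrow> x = 0"
    and symmetric: "\<And>i x y. x \<in> W \<Longrightarrow> y \<in> W \<Longrightarrow> B (T i x) y = B x (T i y)"
    and commute: "\<And>i j x. x \<in> W \<Longrightarrow> T i (T j x) = T j (T i x)"
begin

text \<open>If \<open>u\<close> is not an eigenvector of \<open>T i\<close>, some eigenspace of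
  \<open>T i\<close> in \<open>U\<close> is nonzero and misses \<open>u\<close>. Commutation makes
  it invariant under all operators, so induction on the dimension applies to it.\<close>

lemma joint_eigenvector_exists:
  assumes "subspace U" "U \<subseteq> W" "\<And>i x. x \<in> U \<Longrightarrow> T i x \<in> U" "u \<in> U" "u \<noteq> 0"
  shows "\<exists>e\<in>U. e \<noteq> 0 \<and> (\<forall>i. eigenvector (T i) e)"
  using assms
proof (induction "dim U" arbitrary: U u rule: less_induct)
  case less
  show ?case
  proof (cases "\<forall>i. eigenvector (T i) u")
    case True
    then show ?thesis
      using less.prems by blast
  next
    case False
    then obtain i where i: "\<And>a. T i u \<noteq> a \<cdot> u"
      by (auto simp: eigenvector_def)
    interpret Ti: Vector_Spaces.linear scale scale "T i"
      by (rule T_linear)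
    obtain a e where e: "e \<in> U" "e \<noteq> 0" "T i e = a \<cdot> e"
    proof -
      have "U \<subseteq> span S"
        using less.prems fin by blast
      then show thesis
        using symmetric_has_eigenvector[OF T_linear[of i] less.prems(1) _ fin(1) _ _ _ less.prems(4,5)]
          less.prems(2,3) definite symmetric that
        by (metis subsetD)
    qed
    define U' where "U' = {x \<in> U. T i x = a \<cdot> x}"
    have sub: "subspace U'"
      using less.prems(1) unfolding U'_def subspace_def
      by (auto simp: Ti.zero Ti.add Ti.scale scale_right_distrib scale_left_commute)
    have "U' \<subset> U"
      using i less.prems(4) by (auto simp: U'_def)
    then have "dim U' < dim U"
      using less.prems(2) fin sub by (intro dim_strict_mono_span[of S]) auto
    moreover have "T j x \<in> U'" if "x \<in> U'" for j x
    proof -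
      interpret Tj: Vector_Spaces.linear scale scale "T j"
        by (rule T_linear)
      have x: "x \<in> U" "T i x = a \<cdot> x" "x \<in> W"
        using that less.prems(2) by (auto simp: U'_def)
      have "T i (T j x) = a \<cdot> T j x"
        using commute[OF x(3), of i j] x(2) by (simp add: Tj.scale)
      then show ?thesis
        using less.prems(3) x by (simp add: U'_def)
    qed
    moreover have "e \<in> U'"
      using e by (simp add: U'_def)
    ultimately have "\<exists>e\<in>U'. e \<noteq> 0 \<and> (\<forall>i. eigenvector (T i) e)"
      using less.hyps[OF _ sub, of e] \<open>U' \<subset> U\<close> less.prems(2) e(2) by blast
    then show ?thesis
      using \<open>U' \<subset> U\<close> by blast
  qed
qed

text \<open>By symmetry the orthogonal complement of a joint eigenvector is invariant, so components
  of \<open>u\<close> can be split off one at a time. Only nonzero components are collected, not a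
  full eigenbasis.\<close>

lemma joint_eigenvector_decomposition:
  assumes "subspace U" "U \<subseteq> W" "\<And>i x. x \<in> U \<Longrightarrow> T i x \<in> U" "u \<in> U"
  shows "\<exists>E\<subseteq>U. finite E \<and> card E \<le> dim U \<and> u = \<Sum>E \<and> 0 \<notin> E \<and>
           (\<forall>e\<in>E. \<forall>f\<in>E. e \<noteq> f \<longrightarrow> B e f = 0) \<and> (\<forall>e\<in>E. \<forall>i. eigenvector (T i) e)"
  using assms
proof (induction "dim U" arbitrary: U u rule: less_induct)
  case less
  show ?case
  proof (cases "u = 0")
    case True
    then show ?thesis
      by (intro exI[of _ "{}"] conjI) simp_all
  next
    case False
    obtain e where e: "e \<in> U" "e \<noteq> 0" "\<And>i. eigenvector (T i) e"
      using joint_eigenvector_exists[OF less.prems False] by blast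
    have ee: "B e e \<noteq> 0"
      using definite e less.prems(2) by blast
    define U' where "U' = {x \<in> U. B e x = 0}"
    have sub: "subspace U'"
      using less.prems(1) unfolding U'_def subspace_def
      by (auto simp: B_add_right B_scale_right)
    have psub: "U' \<subset> U"
      using e ee by (auto simp: U'_def)
    then have dim: "dim U' < dim U"
      using less.prems(2) fin sub by (intro dim_strict_mono_span[of S]) auto
    have inv: "T j x \<in> U'" if "x \<in> U'" for j x
    proof -
      obtain a where a: "T j e = a \<cdot> e"
        using e(3) by (auto simp: eigenvector_def)
      have x: "x \<in> U" "B e x = 0"
        using that by (auto simp: U'_def)
      then have "B e (T j x) = B (T j e) x"
        using symmetric e(1) less.prems(2) by (metis subsetD)
      then show ?thesis
        using a x less.prems(3) by (auto simp: U'_def B_scale)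
    qed
    define c where "c = B e u / B e e"
    define u' where "u' = u - c \<cdot> e"
    have "u' \<in> U'"
      using less.prems(1,4) e ee
      by (auto simp: U'_def u'_def c_def B_diff_right B_scale_right intro: subspace_diff subspace_scale)
    have "\<exists>E\<subseteq>U'. finite E \<and> card E \<le> dim U' \<and> u' = \<Sum>E \<and> 0 \<notin> E \<and>
        (\<forall>e\<in>E. \<forall>f\<in>E. e \<noteq> f \<longrightarrow> B e f = 0) \<and> (\<forall>e\<in>E. \<forall>i. eigenvector (T i) e)"
      by (rule less.hyps[OF dim sub]) (use psub less.prems(2) inv \<open>u' \<in> U'\<close> in auto)
    then obtain E where E': "E \<subseteq> U' \<and> finite E \<and> card E \<le> dim U' \<and> u' = \<Sum>E \<and> 0 \<notin> E \<and>
        (\<forall>e\<in>E. \<forall>f\<in>E. e \<noteq> f \<longrightarrow> B e f = 0) \<and> (\<forall>e\<in>E. \<forall>i. eigenvector (T i) e)" ..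
    have E: "E \<subseteq> U'" "finite E" "card E \<le> dim U'" "u' = \<Sum>E" "0 \<notin> E"
      "\<forall>e\<in>E. \<forall>f\<in>E. e \<noteq> f \<longrightarrow> B e f = 0" "\<forall>e\<in>E. \<forall>i. eigenvector (T i) e"
      using E' by simp_all
    have E_sub: "E \<subseteq> U"
      using E(1) psub by blast
    show ?thesis
    proof (cases "c = 0")
      case True
      then have "u' = u"
        by (simp add: u'_def)
      then show ?thesis
        using E E_sub dim by (intro exI[of _ E] conjI) simp_all
    next
      case False
      define f where "f = c \<cdot> e"
      have f: "f \<in> U" "f \<noteq> 0"
        using e False less.prems(1) by (auto simp: f_def subspace_scale)
      have fE: "B f x = 0" if "x \<in> E" for x
        using that E(1) by (auto simp: f_def B_scale U'_def)
      \<comment> \<open>As \<open>E\<close> is a set, the new summand must differ from the old ones;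
        it does, being orthogonal to them but not to itself.\<close>
      have "f \<notin> E"
        using fE[of f] definite f less.prems(2) by blast
      then have "u = \<Sum>(insert f E)"
        using E(2,4) by (simp add: u'_def f_def algebra_simps)
      moreover have "card (insert f E) \<le> dim U"
        using \<open>f \<notin> E\<close> E(2,3) dim by simp
      moreover have "eigenvector (T i) f" for i
      proof -
        interpret Ti: Vector_Spaces.linear scale scale "T i"
          by (rule T_linear)
        obtain a where "T i e = a \<cdot> e"
          using e(3) by (auto simp: eigenvector_def)
        then have "T i f = a \<cdot> f"
          by (simp add: f_def Ti.scale mult.commute)
        then show ?thesis
          unfolding eigenvector_def ..
      qed
      moreover have "B x f = 0" if "x \<in> E" for x
        using fE[OF that] B_sym by metis
      ultimately show ?thesis
        using E E_sub f fE by (intro exI[of _ "insert f E"] conjI) simp_all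
    qed
  qed
qed

end

end

section \<open>Moment columns and truncated multiplication\<close>

definition unit_exponent :: "'d::finite \<Rightarrow> nat ^ 'd" where
  "unit_exponent i = axis i 1"

lemma mdeg_0 [simp]: "mdeg 0 = 0"
  by (simp add: mdeg_def)

lemma mdeg_add [simp]: "mdeg (\<alpha> + \<beta>) = mdeg \<alpha> + mdeg \<beta>"
  by (simp add: mdeg_def sum.distrib)

lemma mdeg_unit_exponent [simp]: "mdeg (unit_exponent i) = 1"
  by (simp add: mdeg_def unit_exponent_def axis_def)

lemma mdeg_eq_0: "mdeg \<alpha> = 0 \<longleftrightarrow> \<alpha> = 0"
  by (auto simp: mdeg_def vec_eq_iff)

lemma mdeg_pos_split:
  assumes "mdeg \<alpha> > 0"
  obtains \<beta> i where "\<alpha> = \<beta> + unit_exponent i"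
proof -
  obtain i where "\<alpha> $ i \<noteq> 0"
    using assms mdeg_eq_0[of \<alpha>] by (auto simp: vec_eq_iff)
  then have "\<alpha> = (\<alpha> - unit_exponent i) + unit_exponent i"
    by (auto simp: vec_eq_iff unit_exponent_def axis_def)
  then show thesis
    using that by blast
qed

lemma exponent_induct [case_names zero step]:
  fixes P :: "nat ^ 'd::finite \<Rightarrow> bool"
  assumes "P 0" "\<And>\<alpha> i. P \<alpha> \<Longrightarrow> P (\<alpha> + unit_exponent i)"
  shows "P \<alpha>"
proof (induction "mdeg \<alpha>" arbitrary: \<alpha>)
  case 0
  then show ?case
    using assms(1) mdeg_eq_0 by metis
next
  case (Suc k)
  then obtain \<beta> i where "\<alpha> = \<beta> + unit_exponent i"
    using mdeg_pos_split by (metis zero_less_Suc)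
  then show ?case
    using Suc assms(2) by auto
qed

text \<open>Serves to write the index of a moment as a column index plus a row index, each of
  bounded degree.\<close>

lemma mdeg_split:
  assumes "mdeg \<alpha> \<le> a + b"
  obtains \<beta> \<gamma> where "\<alpha> = \<beta> + \<gamma>" "mdeg \<beta> \<le> a" "mdeg \<gamma> \<le> b"
proof -
  have "\<exists>\<beta> \<gamma>. \<alpha> = \<beta> + \<gamma> \<and> mdeg \<beta> \<le> a \<and> mdeg \<gamma> \<le> b"
    using assms
  proof (induction b arbitrary: \<alpha>)
    case 0
    then show ?case
      by (intro exI[of _ \<alpha>] exI[of _ 0]) auto
  next
    case (Suc b)
    show ?case
    proof (cases "mdeg \<alpha> = 0")
      case True
      then show ?thesis
        by (intro exI[of _ \<alpha>] exI[of _ 0]) auto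
    next
      case False
      then obtain \<alpha>' i where \<alpha>: "\<alpha> = \<alpha>' + unit_exponent i"
        using mdeg_pos_split by blast
      then have "mdeg \<alpha>' \<le> a + b"
        using Suc.prems by simp
      then obtain \<beta> \<gamma> where "\<alpha>' = \<beta> + \<gamma>" "mdeg \<beta> \<le> a" "mdeg \<gamma> \<le> b"
        using Suc.IH by blast
      then show ?thesis
        using \<alpha> by (intro exI[of _ \<beta>] exI[of _ "\<gamma> + unit_exponent i"]) (auto simp: add.assoc)
    qed
  qed
  then show thesis
    using that by blast
qed

lemma mv_monom_0 [simp]: "mv_monom 0 x = 1"
  by (simp add: mv_monom_def)

lemma mv_monom_add: "mv_monom (\<alpha> + \<beta>) x = mv_monom \<alpha> x * mv_monom \<beta> x"
  by (simp add: mv_monom_def power_add prod.distrib)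

lemma mv_monom_unit_exponent [simp]: "mv_monom (unit_exponent i) x = x $ i"
proof -
  have "mv_monom (unit_exponent i) x = (\<Prod>j\<in>UNIV. if j = i then x $ i else 1)"
    unfolding mv_monom_def by (intro prod.cong) (auto simp: unit_exponent_def axis_def)
  then show ?thesis
    by simp
qed

section \<open>Coefficient functionals and the filtered column space\<close>

lemma sum_fun_apply: "(\<Sum>i\<in>I. f i) x = (\<Sum>i\<in>I. f i x)"
  by (induction I rule: infinite_finite_induct) auto

lemma finite_mdeg_less [simp]: "finite {\<alpha> :: nat ^ 'd::finite. mdeg \<alpha> < k}"
  by (rule finite_subset[OF _ finite_exponents_upto[of k]]) (auto simp: exponents_upto_def)

text \<open>The vectors \<open>w j\<close> may be dependent, so coefficients are not unique. A
  linear choice comes from a one-sided inverse of the map \<open>F\<close> from coefficients to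
  combinations; it is linear on all functions but meaningful only on the span.\<close>

lemma fun_span_linear_coefficients:
  fixes w :: "'i \<Rightarrow> 'a \<Rightarrow> real"
  assumes "finite J"
  obtains L :: "('a \<Rightarrow> real) \<Rightarrow> 'i \<Rightarrow> real" where
    "\<And>f h j. L (f + h) j = L f j + L h j"
    "\<And>c f j. L (\<lambda>a. c * f a) j = c * L f j"
    "\<And>f a. f \<in> fun_vs.span (w ` J) \<Longrightarrow> f a = (\<Sum>j\<in>J. L f j * w j a)"
proof -
  interpret P: vector_space_pair "\<lambda>(c :: real) (f :: 'i \<Rightarrow> real) i. c * f i"
      "\<lambda>(c :: real) (f :: 'a \<Rightarrow> real) i. c * f i"
    by unfold_locales
  define F where "F c = (\<lambda>a. \<Sum>j\<in>J. c j * w j a)" for c :: "'i \<Rightarrow> real"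
  have "Vector_Spaces.linear (\<lambda>c f i. c * f i) (\<lambda>c f i. c * f i) F"
    by unfold_locales (auto simp: F_def fun_eq_iff algebra_simps sum.distrib sum_distrib_left)
  from P.linear_exists_right_inverse_on[OF this fun_vs.subspace_UNIV]
  obtain L where L: "Vector_Spaces.linear (\<lambda>c f i. c * f i) (\<lambda>c f i. c * f i) L"
    "\<And>c. F (L (F c)) = F c"
    by auto
  interpret L: Vector_Spaces.linear "\<lambda>(c :: real) (f :: 'a \<Rightarrow> real) i. c * f i"
      "\<lambda>(c :: real) (f :: 'i \<Rightarrow> real) i. c * f i" L
    by (rule L(1))
  have "\<exists>c. f = F c" if "f \<in> fun_vs.span (w ` J)" for f
    using that
  proof (induction rule: fun_vs.span_induct_alt)
    case base
    then show ?case
      by (intro exI[of _ "\<lambda>_. 0"]) (auto simp: F_def fun_eq_iff)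
  next
    case (step c x y)
    then obtain j d where j: "x = w j" "j \<in> J" and d: "y = F d"
      by blast
    have "(\<lambda>i. c * x i) + y = F (\<lambda>i. (if i = j then c else 0) + d i)"
      using assms j
      by (simp add: F_def d fun_eq_iff distrib_right sum.distrib mult_delta_left)
    then show ?case
      by (rule exI[of _ "\<lambda>i. (if i = j then c else 0) + d i"])
  qed
  then have "f = F (L f)" if "f \<in> fun_vs.span (w ` J)" for f
    using that L(2) by metis
  then have "f a = (\<Sum>j\<in>J. L f j * w j a)" if "f \<in> fun_vs.span (w ` J)" for f a
    using that unfolding F_def by (metis (no_types, lifting))
  moreover have "L (f + h) j = L f j + L h j" for f h j
    by (simp add: L.add)
  moreover have "L (\<lambda>a. c * f a) j = c * L f j" for c f j
    by (simp add: L.scale)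
  ultimately show thesis
    using that by blast
qed

text \<open>Setting the rows of degree above \<open>n\<close> to 0 makes equality of functions the
  equality of matrix columns, in agreement with \<open>rank_on\<close>.\<close>

definition moment_column :: "(nat ^ 'd::finite \<Rightarrow> real) \<Rightarrow> nat \<Rightarrow> nat ^ 'd \<Rightarrow> nat ^ 'd \<Rightarrow> real" where
  "moment_column \<phi> n \<alpha> \<beta> = (if mdeg \<beta> \<le> n then \<phi> (\<beta> + \<alpha>) else 0)"

text \<open>With the strict bound, index 0 gives the zero space, index \<open>n\<close> the space on
  which the operators act, and index \<open>n + 1\<close> the full column space.\<close>

definition column_span :: "(nat ^ 'd::finite \<Rightarrow> real) \<Rightarrow> nat \<Rightarrow> nat \<Rightarrow> (nat ^ 'd \<Rightarrow> real) set" where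
  "column_span \<phi> n k = fun_vs.span (moment_column \<phi> n ` {\<alpha>. mdeg \<alpha> < k})"

lemma subspace_column_span [simp]: "fun_vs.subspace (column_span \<phi> n k)"
  by (simp add: column_span_def)

lemma column_span_mono: "k \<le> l \<Longrightarrow> column_span \<phi> n k \<subseteq> column_span \<phi> n l"
  unfolding column_span_def by (intro fun_vs.span_mono) auto

lemma moment_column_in: "mdeg \<alpha> < k \<Longrightarrow> moment_column \<phi> n \<alpha> \<in> column_span \<phi> n k"
  unfolding column_span_def by (intro fun_vs.span_base) auto

lemma column_span_vanish:
  assumes "f \<in> column_span \<phi> n k" "mdeg \<beta> > n"
  shows "f \<beta> = 0"
  using assms(1) unfolding column_span_def
  by (induction rule: fun_vs.span_induct_alt) (use assms(2) in \<open>auto simp: moment_column_def\<close>)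

text \<open>On the column space of a positive semidefinite matrix, \<open>B\<close> is the reproducing-kernel
  inner product; it represents the form \<open>p, q \<mapsto> \<phi>(p q)\<close>.\<close>

lemma reproducing_form_exists:
  fixes \<phi> :: "nat ^ 'd::finite \<Rightarrow> real"
  assumes "psd_on (exponents_upto n) (moment_matrix \<phi>)"
  obtains B where "psd_form (\<lambda>c f i. c * f i) B"
    "\<And>\<alpha> h. h \<in> column_span \<phi> n (n + 1) \<Longrightarrow> mdeg \<alpha> \<le> n \<Longrightarrow> B (moment_column \<phi> n \<alpha>) h = h \<alpha>"
proof -
  define J where "J = {\<alpha> :: nat ^ 'd. mdeg \<alpha> < n + 1}"
  have J: "J = exponents_upto n" "finite J"
    by (auto simp: J_def exponents_upto_def)
  let ?w = "moment_column \<phi> n"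
  obtain L :: "(nat ^ 'd \<Rightarrow> real) \<Rightarrow> nat ^ 'd \<Rightarrow> real" where L:
    "\<And>f h j. L (f + h) j = L f j + L h j"
    "\<And>c f j. L (\<lambda>a. c * f a) j = c * L f j"
    "\<And>f a. f \<in> fun_vs.span (?w ` J) \<Longrightarrow> f a = (\<Sum>j\<in>J. L f j * ?w j a)"
    by (rule fun_span_linear_coefficients[OF J(2), of ?w]) blast
  define B where "B f h = (\<Sum>\<alpha>\<in>J. \<Sum>\<beta>\<in>J. L f \<alpha> * \<phi> (\<alpha> + \<beta>) * L h \<beta>)" for f h
  have "psd_form (\<lambda>c f i. c * f i) B"
  proof unfold_locales
    fix x y z :: "nat ^ 'd \<Rightarrow> real" and c :: real
    show "B (x + y) z = B x z + B y z"
      by (simp add: B_def L(1) algebra_simps sum.distrib)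
    show "B (\<lambda>i. c * x i) z = c * B x z"
      by (simp add: B_def L(2) algebra_simps sum_distrib_left)
    show "B x y = B y x"
      unfolding B_def by (subst sum.swap) (simp add: algebra_simps)
    show "0 \<le> B x x"
      using assms J unfolding psd_on_def B_def moment_matrix_def by auto
  qed
  moreover have "B (?w \<alpha>) h = h \<alpha>" if h: "h \<in> column_span \<phi> n (n + 1)" and \<alpha>: "mdeg \<alpha> \<le> n" for \<alpha> h
  proof -
    have w: "?w \<alpha> \<in> fun_vs.span (?w ` J)"
      using \<alpha> by (intro fun_vs.span_base) (auto simp: J_def)
    have "B (?w \<alpha>) h = (\<Sum>\<beta>\<in>J. (\<Sum>\<gamma>\<in>J. L (?w \<alpha>) \<gamma> * \<phi> (\<gamma> + \<beta>)) * L h \<beta>)"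
      unfolding B_def by (subst sum.swap) (simp add: sum_distrib_right)
    also have "\<dots> = (\<Sum>\<beta>\<in>J. (\<Sum>\<gamma>\<in>J. L (?w \<alpha>) \<gamma> * ?w \<gamma> \<beta>) * L h \<beta>)"
      by (intro sum.cong refl arg_cong2[where f = times])
        (auto simp: moment_column_def J_def add.commute)
    also have "\<dots> = (\<Sum>\<beta>\<in>J. ?w \<alpha> \<beta> * L h \<beta>)"
      using L(3)[OF w] by simp
    also have "\<dots> = (\<Sum>\<beta>\<in>J. L h \<beta> * ?w \<beta> \<alpha>)"
      using \<alpha> by (intro sum.cong) (auto simp: moment_column_def J_def add.commute)
    also have "\<dots> = h \<alpha>"
      using L(3)[of h \<alpha>] h by (simp add: column_span_def J_def)
    finally show ?thesis .
  qed
  ultimately show thesis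
    using that by blast
qed

text \<open>\<open>T\<close> is multiplication by the \<open>i\<close>-th variable followed by the orthogonal projection onto
  the span of the columns of degree less than \<open>n\<close>; in terms of function values this is a shift.\<close>

lemma shift_operator_exists:
  fixes \<phi> :: "nat ^ 'd::finite \<Rightarrow> real" and i :: 'd
  assumes "psd_on (exponents_upto n) (moment_matrix \<phi>)"
  shows "\<exists>T. Vector_Spaces.linear (\<lambda>c f i. c * f i) (\<lambda>c f i. c * f i) T \<and>
    (\<forall>f. T f \<in> column_span \<phi> n n) \<and>
    (\<forall>f\<in>column_span \<phi> n n. \<forall>\<beta>. mdeg \<beta> < n \<longrightarrow> T f \<beta> = f (\<beta> + unit_exponent i))"
proof -
  obtain B where B: "psd_form (\<lambda>c f i. c * f i) B"
    "\<And>\<alpha> h. h \<in> column_span \<phi> n (n + 1) \<Longrightarrow> mdeg \<alpha> \<le> n \<Longrightarrow> B (moment_column \<phi> n \<alpha>) h = h \<alpha>"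
    by (rule reproducing_form_exists[OF assms]) blast
  interpret psd_form "\<lambda>(c :: real) (f :: nat ^ 'd \<Rightarrow> real) i. c * f i" B
    by (rule B(1))
  let ?w = "moment_column \<phi> n"
  define J where "J = {\<alpha> :: nat ^ 'd. mdeg \<alpha> < n}"
  have finJ: "finite J"
    by (simp add: J_def)
  obtain L :: "(nat ^ 'd \<Rightarrow> real) \<Rightarrow> nat ^ 'd \<Rightarrow> real" where L:
    "\<And>f h j. L (f + h) j = L f j + L h j"
    "\<And>c f j. L (\<lambda>a. c * f a) j = c * L f j"
    "\<And>f a. f \<in> fun_vs.span (?w ` J) \<Longrightarrow> f a = (\<Sum>j\<in>J. L f j * ?w j a)"
    by (rule fun_span_linear_coefficients[OF finJ, of ?w]) blast
  \<comment> \<open>Projecting onto the columns of degree less than \<open>n\<close> keeps the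
    values at indices of degree less than \<open>n\<close>, because these values are the inner
    products with those columns.\<close>
  have "\<exists>h\<in>column_span \<phi> n n. \<forall>\<beta>. mdeg \<beta> < n \<longrightarrow> h \<beta> = ?w (\<alpha> + unit_exponent i) \<beta>"
    if "\<alpha> \<in> J" for \<alpha>
  proof -
    have w: "?w (\<alpha> + unit_exponent i) \<in> column_span \<phi> n (n + 1)"
      using that by (intro moment_column_in) (auto simp: J_def)
    obtain h where h: "h \<in> column_span \<phi> n n"
      "\<And>y. y \<in> column_span \<phi> n n \<Longrightarrow> B (?w (\<alpha> + unit_exponent i) - h) y = 0"
      using orthogonal_projection_exists[of "?w ` J" "?w (\<alpha> + unit_exponent i)"] finJ
      unfolding column_span_def J_def by auto
    have "h \<beta> = ?w (\<alpha> + unit_exponent i) \<beta>" if "mdeg \<beta> < n" for \<beta>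
    proof -
      have "B (?w \<beta>) (?w (\<alpha> + unit_exponent i) - h) = 0"
        using h(2)[OF moment_column_in[OF that]] B_sym by metis
      moreover have "h \<in> column_span \<phi> n (n + 1)"
        using h(1) column_span_mono[of n "n + 1"] by auto
      ultimately show ?thesis
        using B(2)[OF w, of \<beta>] B(2)[of h \<beta>] that by (simp add: B_diff_right)
    qed
    then show ?thesis
      using h(1) by blast
  qed
  then obtain h where h: "\<And>\<alpha>. \<alpha> \<in> J \<Longrightarrow> h \<alpha> \<in> column_span \<phi> n n"
    "\<And>\<alpha> \<beta>. \<alpha> \<in> J \<Longrightarrow> mdeg \<beta> < n \<Longrightarrow> h \<alpha> \<beta> = ?w (\<alpha> + unit_exponent i) \<beta>"
    by metis
  \<comment> \<open>Relations among the columns do no harm: for \<open>mdeg \<beta> < n\<close> the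
    combination has the value \<open>f (\<beta> + unit_exponent i)\<close>, an index of degree at
    most \<open>n\<close>.\<close>
  define T where "T f = (\<Sum>\<alpha>\<in>J. (\<lambda>\<beta>. L f \<alpha> * h \<alpha> \<beta>))" for f
  have T_apply: "T f \<beta> = (\<Sum>\<alpha>\<in>J. L f \<alpha> * h \<alpha> \<beta>)" for f \<beta>
    by (simp add: T_def sum_fun_apply)
  have "Vector_Spaces.linear (\<lambda>c f i. c * f i) (\<lambda>c f i. c * f i) T"
  proof unfold_locales
    fix f g :: "nat ^ 'd \<Rightarrow> real" and c :: real
    show "T (f + g) = T f + T g"
      by (rule ext) (simp add: T_apply L(1) distrib_right sum.distrib)
    show "T (\<lambda>i. c * f i) = (\<lambda>i. c * T f i)"
      by (rule ext) (simp add: T_apply L(2) sum_distrib_left mult.assoc)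
  qed
  moreover have "T f \<in> column_span \<phi> n n" for f
  proof -
    have "(\<lambda>\<beta>. L f \<alpha> * h \<alpha> \<beta>) \<in> column_span \<phi> n n" if "\<alpha> \<in> J" for \<alpha>
      by (rule fun_vs.subspace_scale[OF subspace_column_span h(1)[OF that]])
    then show ?thesis
      unfolding T_def by (rule fun_vs.subspace_sum[OF subspace_column_span])
  qed
  moreover have "T f \<beta> = f (\<beta> + unit_exponent i)" if f: "f \<in> column_span \<phi> n n" and \<beta>: "mdeg \<beta> < n" for f \<beta>
  proof -
    have "T f \<beta> = (\<Sum>\<alpha>\<in>J. L f \<alpha> * ?w \<alpha> (\<beta> + unit_exponent i))"
      unfolding T_apply using h(2) \<beta>
      by (intro sum.cong refl) (simp add: moment_column_def add.assoc add.commute add.left_commute)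
    also have "\<dots> = f (\<beta> + unit_exponent i)"
      using L(3)[of f] f by (simp add: column_span_def J_def)
    finally show ?thesis .
  qed
  ultimately show ?thesis
    by blast
qed

section \<open>Symmetry and commutation of the projected multiplications\<close>

locale moment_operators = psd_form "\<lambda>(c :: real) (f :: nat ^ 'd::finite \<Rightarrow> real) i. c * f i" B
  for B :: "(nat ^ 'd::finite \<Rightarrow> real) \<Rightarrow> (nat ^ 'd \<Rightarrow> real) \<Rightarrow> real" +
  fixes \<phi> :: "nat ^ 'd \<Rightarrow> real" and n :: nat
    and T :: "'d \<Rightarrow> (nat ^ 'd \<Rightarrow> real) \<Rightarrow> (nat ^ 'd \<Rightarrow> real)"
  assumes reproducing: "h \<in> column_span \<phi> n (n + 1) \<Longrightarrow> mdeg \<alpha> \<le> n \<Longrightarrow>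
      B (moment_column \<phi> n \<alpha>) h = h \<alpha>"
    and T_linear: "Vector_Spaces.linear (\<lambda>c f i. c * f i) (\<lambda>c f i. c * f i) (T i)"
    and T_in: "T i f \<in> column_span \<phi> n n"
    and T_shift: "f \<in> column_span \<phi> n n \<Longrightarrow> mdeg \<beta> < n \<Longrightarrow> T i f \<beta> = f (\<beta> + unit_exponent i)"
begin

abbreviation w :: "nat ^ 'd \<Rightarrow> nat ^ 'd \<Rightarrow> real" where
  "w \<equiv> moment_column \<phi> n"

abbreviation V :: "nat \<Rightarrow> (nat ^ 'd \<Rightarrow> real) set" where
  "V \<equiv> column_span \<phi> n"

lemma T_add: "T i (f + g) = T i f + T i g"
proof -
  interpret Ti: Vector_Spaces.linear "\<lambda>(c :: real) (f :: nat ^ 'd \<Rightarrow> real) i. c * f i"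
      "\<lambda>(c :: real) (f :: nat ^ 'd \<Rightarrow> real) i. c * f i" "T i"
    by (rule T_linear)
  show ?thesis
    by (rule Ti.add)
qed

lemma T_scale: "T i (\<lambda>\<alpha>. c * f \<alpha>) = (\<lambda>\<alpha>. c * T i f \<alpha>)"
proof -
  interpret Ti: Vector_Spaces.linear "\<lambda>(c :: real) (f :: nat ^ 'd \<Rightarrow> real) i. c * f i"
      "\<lambda>(c :: real) (f :: nat ^ 'd \<Rightarrow> real) i. c * f i" "T i"
    by (rule T_linear)
  show ?thesis
    by (rule Ti.scale)
qed

lemma T_0: "T i 0 = 0"
  using T_add[of i 0 0] by simp

lemma T_sum: "T i (\<Sum>e\<in>E. f e) = (\<Sum>e\<in>E. T i (f e))"
proof -
  interpret Ti: Vector_Spaces.linear "\<lambda>(c :: real) (f :: nat ^ 'd \<Rightarrow> real) i. c * f i"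
      "\<lambda>(c :: real) (f :: nat ^ 'd \<Rightarrow> real) i. c * f i" "T i"
    by (rule T_linear)
  show ?thesis
    by (rule Ti.sum)
qed

lemma V_sub_full: "f \<in> V n \<Longrightarrow> f \<in> V (n + 1)"
  using column_span_mono[of n "n + 1"] by auto

lemma V_induct [consumes 1, case_names base step]:
  assumes "f \<in> V k" "P 0"
    "\<And>c \<alpha> g. mdeg \<alpha> < k \<Longrightarrow> g \<in> V k \<Longrightarrow> P g \<Longrightarrow> P ((\<lambda>\<beta>. c * w \<alpha> \<beta>) + g)"
  shows "P f"
proof -
  have "f \<in> V k \<and> P f"
    using assms(1) unfolding column_span_def
  proof (induction rule: fun_vs.span_induct_alt)
    case base
    show "0 \<in> fun_vs.span (w ` {\<alpha>. mdeg \<alpha> < k}) \<and> P 0"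
      using assms(2) by (intro conjI fun_vs.span_zero)
  next
    case (step c x y)
    then obtain \<alpha> where \<alpha>: "x = w \<alpha>" "mdeg \<alpha> < k"
      by auto
    have "x \<in> fun_vs.span (w ` {\<alpha>. mdeg \<alpha> < k})"
      using \<alpha> by (intro fun_vs.span_base) auto
    then have "(\<lambda>\<beta>. c * x \<beta>) + y \<in> fun_vs.span (w ` {\<alpha>. mdeg \<alpha> < k})"
      using step by (intro fun_vs.span_add fun_vs.span_scale) auto
    moreover have "P ((\<lambda>\<beta>. c * x \<beta>) + y)"
      using step assms(3)[OF \<alpha>(2), of y c] \<alpha>(1) by (simp only: column_span_def)
    ultimately show "(\<lambda>\<beta>. c * x \<beta>) + y \<in> fun_vs.span (w ` {\<alpha>. mdeg \<alpha> < k}) \<and>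
        P ((\<lambda>\<beta>. c * x \<beta>) + y)"
      by blast
  qed
  then show ?thesis ..
qed

text \<open>Every value of \<open>f\<close> in degree at most \<open>n\<close> is an inner product
  with \<open>f\<close>, and null vectors are orthogonal to everything.\<close>

lemma definite_full:
  assumes "f \<in> V (n + 1)" "B f f = 0"
  shows "f = 0"
proof
  fix \<beta>
  show "f \<beta> = 0 \<beta>"
  proof (cases "mdeg \<beta> \<le> n")
    case True
    then have "f \<beta> = B (w \<beta>) f"
      using reproducing assms(1) by simp
    then show ?thesis
      using B_null[OF assms(2)] B_sym by simp
  next
    case False
    then show ?thesis
      using column_span_vanish[OF assms(1)] by simp
  qed
qed

lemma definite: "f \<in> V n \<Longrightarrow> B f f = 0 \<Longrightarrow> f = 0"
  using definite_full V_sub_full by blast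

text \<open>The values in degree less than \<open>n\<close> are the inner products with a spanning
  set of \<open>V n\<close>. Identities in \<open>V n\<close> can therefore be checked in the range
  that \<open>T_shift\<close> controls.\<close>

lemma V_eq_0:
  assumes "f \<in> V n" "\<And>\<beta>. mdeg \<beta> < n \<Longrightarrow> f \<beta> = 0"
  shows "f = 0"
proof (rule definite[OF assms(1)])
  have "B f s = 0" if "s \<in> w ` {\<alpha>. mdeg \<alpha> < n}" for s
    using that assms(2) reproducing[OF V_sub_full[OF assms(1)]] B_sym by auto
  then show "B f f = 0"
    using span_orthogonal[of "w ` {\<alpha>. mdeg \<alpha> < n}" f f] assms(1) by (simp add: column_span_def)
qed

lemma V_eqI:
  assumes "f \<in> V n" "g \<in> V n" "\<And>\<beta>. mdeg \<beta> < n \<Longrightarrow> f \<beta> = g \<beta>"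
  shows "f = g"
proof -
  have "f - g = 0"
    using assms by (intro V_eq_0) (auto intro: fun_vs.subspace_diff)
  then show ?thesis
    by simp
qed

text \<open>If the multiplied column already lies in \<open>V n\<close>, the projection leaves it
  unchanged.\<close>

lemma T_column:
  assumes "mdeg \<alpha> < n" "w (\<alpha> + unit_exponent i) \<in> V n"
  shows "T i (w \<alpha>) = w (\<alpha> + unit_exponent i)"
proof (rule V_eqI[OF T_in assms(2)])
  fix \<beta> :: "nat ^ 'd" assume "mdeg \<beta> < n"
  then show "T i (w \<alpha>) \<beta> = w (\<alpha> + unit_exponent i) \<beta>"
    using T_shift[OF moment_column_in[OF assms(1)]]
    by (simp add: moment_column_def add.assoc add.commute[of \<alpha>])
qed

lemma T_column_apply:
  assumes "mdeg \<alpha> < n" "mdeg \<beta> < n"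
  shows "T i (w \<alpha>) \<beta> = \<phi> (\<alpha> + \<beta> + unit_exponent i)"
  using T_shift[OF moment_column_in[OF assms(1)] assms(2)] assms(2)
  by (simp add: moment_column_def add.assoc add.left_commute add.commute)

text \<open>On columns of index \<alpha> and \<beta> both sides are the moment of
  \<open>\<alpha> + \<beta> + unit_exponent i\<close>, which is symmetric in the two
  indices.\<close>

lemma T_symmetric:
  assumes "f \<in> V n" "g \<in> V n"
  shows "B (T i f) g = B f (T i g)"
proof -
  have *: "B (T i (w \<alpha>)) g = B (w \<alpha>) (T i g)" if "mdeg \<alpha> < n" for \<alpha>
  proof -
    have "B g (T i (w \<alpha>)) = T i g \<alpha>"
      using assms(2)
    proof (induction rule: V_induct)
      case base
      show "B 0 (T i (w \<alpha>)) = T i 0 \<alpha>"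
        by (simp add: T_0)
    next
      case (step c \<beta> g)
      have "B (w \<beta>) (T i (w \<alpha>)) = T i (w \<alpha>) \<beta>"
        using step(1) by (intro reproducing V_sub_full T_in) auto
      also have "\<dots> = T i (w \<beta>) \<alpha>"
        using T_column_apply that step(1) by (simp add: add.commute)
      finally show "B ((\<lambda>\<gamma>. c * w \<beta> \<gamma>) + g) (T i (w \<alpha>)) = T i ((\<lambda>\<gamma>. c * w \<beta> \<gamma>) + g) \<alpha>"
        using step by (simp add: B_add B_scale T_add T_scale)
    qed
    then show ?thesis
      using reproducing[OF V_sub_full[OF T_in[of i g]], of \<alpha>] that B_sym by simp
  qed
  show ?thesis
    using assms(1)
  proof (induction rule: V_induct)
    case base
    show "B (T i 0) g = B 0 (T i g)"
      by (simp add: T_0)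
  next
    case (step c \<alpha> f)
    then show "B (T i ((\<lambda>\<gamma>. c * w \<alpha> \<gamma>) + f)) g = B ((\<lambda>\<gamma>. c * w \<alpha> \<gamma>) + f) (T i g)"
      using * by (simp add: B_add B_scale T_add T_scale)
  qed
qed

text \<open>When neither first multiplication needs a projection, both orders give the moment of
  \<open>\<alpha> + \<beta> + unit_exponent i + unit_exponent j\<close> at row \<beta>; the second
  projection does not affect rows of degree less than \<open>n\<close>.\<close>

lemma commute_column:
  assumes "mdeg \<alpha> < n" "w (\<alpha> + unit_exponent i) \<in> V n" "w (\<alpha> + unit_exponent j) \<in> V n"
  shows "T i (T j (w \<alpha>)) = T j (T i (w \<alpha>))"
proof (rule V_eqI[OF T_in T_in])
  fix \<beta> :: "nat ^ 'd" assume \<beta>: "mdeg \<beta> < n"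
  have "T i (T j (w \<alpha>)) \<beta> = w (\<alpha> + unit_exponent j) (\<beta> + unit_exponent i)"
    using T_shift[OF assms(3) \<beta>] T_column[OF assms(1,3)] by simp
  moreover have "T j (T i (w \<alpha>)) \<beta> = w (\<alpha> + unit_exponent i) (\<beta> + unit_exponent j)"
    using T_shift[OF assms(2) \<beta>] T_column[OF assms(1,2)] by simp
  ultimately show "T i (T j (w \<alpha>)) \<beta> = T j (T i (w \<alpha>)) \<beta>"
    using \<beta> by (simp add: moment_column_def add.assoc add.left_commute add.commute)
qed

lemma commute_on:
  assumes "\<And>\<alpha> i. mdeg \<alpha> < k \<Longrightarrow> w (\<alpha> + unit_exponent i) \<in> V n" "k \<le> n" "f \<in> V k"
  shows "T i (T j f) = T j (T i f)"
  using assms(3)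
proof (induction rule: V_induct)
  case base
  show "T i (T j 0) = T j (T i 0)"
    by (simp add: T_0)
next
  case (step c \<alpha> g)
  then show "T i (T j ((\<lambda>\<beta>. c * w \<alpha> \<beta>) + g)) = T j (T i ((\<lambda>\<beta>. c * w \<alpha> \<beta>) + g))"
    using commute_column[of \<alpha> i j] assms(1,2) by (simp add: T_add T_scale)
qed

lemma dim_V_strict_mono: "V k \<subset> V l \<Longrightarrow> dim (V k) < dim (V l)"
  by (rule dim_strict_mono_span[of "w ` {\<alpha>. mdeg \<alpha> < l}"]) (auto simp: column_span_def)

text \<open>The operators always commute on the columns of degree less than \<open>n - 1\<close>. As commutators of
  symmetric operators are antisymmetric, they vanish if the remaining codimension is at most 1.\<close>

lemma commute_codim_1:
  assumes "dim (V n) \<le> dim (V (n - 1)) + 1" "f \<in> V n"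
  shows "T i (T j f) = T j (T i f)"
proof (cases "V n = V (n - 1)")
  case True
  have "T i (T j f) = T j (T i f)" if "f \<in> V (n - 1)"
    by (rule commute_on[OF _ _ that]) (auto intro: moment_column_in)
  then show ?thesis
    using True assms(2) by simp
next
  case False
  define K where "K f = T i (T j f) - T j (T i f)" for f
  have K_add: "K (f + g) = K f + K g" and K_scale: "K (\<lambda>\<alpha>. c * f \<alpha>) = (\<lambda>\<alpha>. c * K f \<alpha>)" for f g c
    by (auto simp: K_def T_add T_scale fun_eq_iff algebra_simps)
  have K_in: "K f \<in> V n" for f
    unfolding K_def by (intro fun_vs.subspace_diff T_in subspace_column_span)
  have K_small: "K y = 0" if "y \<in> V (n - 1)" for y
  proof -
    have "T i (T j y) = T j (T i y)"
      by (rule commute_on[OF _ _ that]) (auto intro: moment_column_in)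
    then show ?thesis
      by (simp add: K_def)
  qed
  have anti: "B (K f) g = - B f (K g)" if "f \<in> V n" "g \<in> V n" for f g
    using that T_symmetric T_in by (simp add: K_def B_diff B_diff_right)
  have sub: "V (n - 1) \<subseteq> V n"
    by (rule column_span_mono) simp
  obtain f0 where f0: "f0 \<in> V n" "f0 \<notin> V (n - 1)"
    using sub False by blast
  \<comment> \<open>By the codimension bound, adding the single vector \<open>f0\<close> to
    \<open>V (n - 1)\<close> already gives \<open>V n\<close>.\<close>
  define U where "U = span (insert f0 (w ` {\<alpha>. mdeg \<alpha> < n - 1}))"
  have U: "\<exists>c. g - (\<lambda>\<alpha>. c * f0 \<alpha>) \<in> V (n - 1)" if "g \<in> U" for g
    using that unfolding U_def column_span_def by (simp add: span_breakdown_eq)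
  have "V (n - 1) \<subseteq> U"
    unfolding U_def column_span_def by (rule span_mono) auto
  moreover have "f0 \<in> U"
    unfolding U_def by (rule span_base) simp
  ultimately have "V (n - 1) \<subset> U"
    using f0 by blast
  then have "dim (V (n - 1)) < dim U"
    by (intro dim_strict_mono_span[of "insert f0 (w ` {\<alpha>. mdeg \<alpha> < n - 1})"]) (auto simp: U_def)
  moreover have "U \<subseteq> V n"
    unfolding U_def using f0(1) by (intro span_minimal) (auto intro: moment_column_in)
  moreover have "dim U < dim (V n)" if "U \<subset> V n"
    using that by (intro dim_strict_mono_span[of "w ` {\<alpha>. mdeg \<alpha> < n}"]) (auto simp: U_def column_span_def)
  ultimately have "U = V n"
    using assms(1) by force
  then obtain c where c: "K f0 - (\<lambda>\<alpha>. c * f0 \<alpha>) \<in> V (n - 1)"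
    using U K_in by blast
  \<comment> \<open>Split \<open>K f0\<close> into \<open>y\<close> in \<open>V (n - 1)\<close> and
    a multiple of \<open>f0\<close>. It is orthogonal to \<open>y\<close> because
    \<open>K y = 0\<close>, and to \<open>f0\<close> by antisymmetry, hence to itself.\<close>
  define y where "y = K f0 - (\<lambda>\<alpha>. c * f0 \<alpha>)"
  have "K f0 = y + (\<lambda>\<alpha>. c * f0 \<alpha>)" "y \<in> V (n - 1)"
    using c by (auto simp: y_def)
  moreover have "B (K f0) y = 0"
    using anti[OF f0(1), of y] K_small[of y] \<open>y \<in> V (n - 1)\<close> sub by auto
  moreover have "B (K f0) f0 = 0"
    using anti[OF f0(1) f0(1)] B_sym[of f0 "K f0"] by simp
  ultimately have "B (K f0) (K f0) = 0"
    using B_add_right[of "K f0" y "\<lambda>\<alpha>. c * f0 \<alpha>"] B_scale_right[of "K f0" c f0] by simp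
  then have K0: "K f0 = 0"
    using definite K_in by blast
  obtain c' where c': "f - (\<lambda>\<alpha>. c' * f0 \<alpha>) \<in> V (n - 1)"
    using U \<open>U = V n\<close> assms(2) by blast
  have "K f = K ((f - (\<lambda>\<alpha>. c' * f0 \<alpha>)) + (\<lambda>\<alpha>. c' * f0 \<alpha>))"
    by simp
  also have "\<dots> = 0"
    unfolding K_add K_scale K_small[OF c'] K0 by (simp add: fun_eq_iff)
  finally show ?thesis
    by (simp add: K_def)
qed

lemma commute:
  assumes "V (n + 1) = V n \<or> dim (V n) \<le> dim (V (n - 1)) + 1" "f \<in> V n"
  shows "T i (T j f) = T j (T i f)"
  using assms(1)
proof
  assume "V (n + 1) = V n"
  then show ?thesis
    using moment_column_in[of _ "n + 1" \<phi> n] by (intro commute_on[OF _ _ assms(2)]) auto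
next
  assume "dim (V n) \<le> dim (V (n - 1)) + 1"
  then show ?thesis
    by (rule commute_codim_1[OF _ assms(2)])
qed

text \<open>Once multiplication by the variables leads to no new columns it never does, as long as
  \<open>T\<close> acts without projection. That is guaranteed only for products inside
  \<open>V n\<close>, hence the bound \<open>l \<le> n\<close>: the columns of degree
  \<open>n\<close> enter at \<open>V (n + 1)\<close> and may be new.\<close>

lemma column_span_stable:
  assumes "V (k + 1) = V k" "k \<le> l" "l \<le> n"
  shows "V l = V k"
  using assms(2,3)
proof (induction l rule: dec_induct)
  case base
  then show ?case by simp
next
  case (step l)
  have IH: "V l = V k"
    using step by simp
  show ?case
  proof (cases "l = k")
    case True
    then show ?thesis
      using assms(1) by simp
  next
    case False
    \<comment> \<open>Since \<open>l > k\<close>, the preceding space already equals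
      \<open>V l\<close>; as \<open>T\<close> raises the degree by at most one there, it maps
      \<open>V l\<close> into itself.\<close>
    obtain l' where l': "l = l' + 1"
      using False step(1) by (cases l) auto
    have T_V: "T i f \<in> V l" if "f \<in> V l'" for i f
      using that
    proof (induction rule: V_induct)
      case base
      show "T i 0 \<in> V l"
        unfolding T_0 by (rule fun_vs.subspace_0[OF subspace_column_span])
    next
      case (step c \<alpha> g)
      have "T i (w \<alpha>) = w (\<alpha> + unit_exponent i)"
        using step(1) l' \<open>Suc l \<le> n\<close> by (intro T_column moment_column_in) auto
      moreover have "w (\<alpha> + unit_exponent i) \<in> V l"
        using step(1) l' by (intro moment_column_in) auto
      ultimately have "T i (w \<alpha>) \<in> V l"
        by simp
      from fun_vs.subspace_scale[OF subspace_column_span this, of c] step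
      show "T i ((\<lambda>\<beta>. c * w \<alpha> \<beta>) + g) \<in> V l"
        unfolding T_add T_scale by (intro fun_vs.subspace_add[OF subspace_column_span])
    qed
    have V_l': "V l' = V l"
    proof -
      have "V k \<subseteq> V l'" "V l' \<subseteq> V l"
        using False step(1) l' by (auto intro!: column_span_mono)
      then show ?thesis
        using IH by blast
    qed
    have "w \<alpha> \<in> V l" if \<alpha>: "mdeg \<alpha> < Suc l" for \<alpha>
    proof (cases "mdeg \<alpha> = 0")
      case True
      then show ?thesis
        using l' by (intro moment_column_in) auto
    next
      case False
      then obtain \<beta> i where \<beta>: "\<alpha> = \<beta> + unit_exponent i"
        using mdeg_pos_split by blast
      then have "w \<beta> \<in> V l'"
        unfolding V_l' using \<alpha> by (intro moment_column_in) auto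
      moreover have "T i (w \<beta>) = w \<alpha>"
        unfolding \<beta> using \<beta> \<alpha> \<open>Suc l \<le> n\<close> by (intro T_column moment_column_in) auto
      ultimately show ?thesis
        using T_V by metis
    qed
    then have "V (Suc l) \<subseteq> V l"
      unfolding column_span_def[of _ _ "Suc l"] by (intro fun_vs.span_minimal) auto
    then show ?thesis
      using IH column_span_mono[of l "Suc l" \<phi> n] by auto
  qed
qed

section \<open>Atoms\<close>

text \<open>The members of \<open>E\<close> are the eigencomponents of \<open>w 0\<close>, the class
  of 1, and the coordinates of an atom are the joint eigenvalues. Orthogonality gives
  \<open>e 0 = B e e\<close>, and shifting multiplies by coordinates, which yields all values of
  \<open>e\<close>. Applying the operators to \<open>w 0\<close> reaches the columns in
  \<open>V n\<close>, so moments are exact whenever the column part of the index has its column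
  there.\<close>

lemma atoms_exist:
  assumes "n > 0" and comm: "V (n + 1) = V n \<or> dim (V n) \<le> dim (V (n - 1)) + 1"
  obtains E and x :: "(nat ^ 'd \<Rightarrow> real) \<Rightarrow> real ^ 'd" where
    "finite E" "E \<subseteq> V n" "card E \<le> dim (V n)"
    "\<And>e. e \<in> E \<Longrightarrow> B e e > 0" "\<And>e f. e \<in> E \<Longrightarrow> f \<in> E \<Longrightarrow> e \<noteq> f \<Longrightarrow> B e f = 0"
    "\<And>e \<gamma>. e \<in> E \<Longrightarrow> mdeg \<gamma> \<le> n \<Longrightarrow> e \<gamma> = mv_monom \<gamma> (x e) * B e e"
    "\<And>\<beta> \<gamma>. mdeg \<beta> \<le> n \<Longrightarrow> w \<beta> \<in> V n \<Longrightarrow> mdeg \<gamma> \<le> n \<Longrightarrow>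
        \<phi> (\<beta> + \<gamma>) = (\<Sum>e\<in>E. mv_monom (\<beta> + \<gamma>) (x e) * B e e)"
proof -
  have w0: "w 0 \<in> V n"
    using assms(1) by (intro moment_column_in) simp
  have "\<exists>E\<subseteq>V n. finite E \<and> card E \<le> dim (V n) \<and> w 0 = \<Sum>E \<and> 0 \<notin> E \<and>
      (\<forall>e\<in>E. \<forall>f\<in>E. e \<noteq> f \<longrightarrow> B e f = 0) \<and> (\<forall>e\<in>E. \<forall>i. eigenvector (T i) e)"
  proof (rule joint_eigenvector_decomposition[where S = "w ` {\<alpha>. mdeg \<alpha> < n}" and W = "V n"])
    show "V n \<subseteq> span (w ` {\<alpha>. mdeg \<alpha> < n})"
      by (simp add: column_span_def)
  qed (use T_linear definite T_symmetric commute[OF comm] T_in w0 in auto)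
  then obtain E where E': "E \<subseteq> V n \<and> finite E \<and> card E \<le> dim (V n) \<and> w 0 = \<Sum>E \<and> 0 \<notin> E \<and>
      (\<forall>e\<in>E. \<forall>f\<in>E. e \<noteq> f \<longrightarrow> B e f = 0) \<and> (\<forall>e\<in>E. \<forall>i. eigenvector (T i) e)" ..
  then have E: "E \<subseteq> V n" "finite E" "card E \<le> dim (V n)" "w 0 = \<Sum>E" "0 \<notin> E"
    "\<And>e f. e \<in> E \<Longrightarrow> f \<in> E \<Longrightarrow> e \<noteq> f \<Longrightarrow> B e f = 0" "\<And>e i. e \<in> E \<Longrightarrow> eigenvector (T i) e"
    by auto
  have "\<forall>e\<in>E. \<forall>i. \<exists>a. T i e = (\<lambda>\<alpha>. a * e \<alpha>)"
    using E(7) by (simp add: eigenvector_def)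
  then obtain a where a: "\<And>e i. e \<in> E \<Longrightarrow> T i e = (\<lambda>\<alpha>. a e i * e \<alpha>)"
    by metis
  define x where "x e = (\<chi> i. a e i)" for e
  have T_e: "T i e = (\<lambda>\<alpha>. x e $ i * e \<alpha>)" if "e \<in> E" for e i
    using a[OF that] by (simp add: x_def)
  have pos: "B e e > 0" if "e \<in> E" for e
    using that E(1,5) definite B_nonneg[of e] by (metis less_eq_real_def subsetD)
  have e_apply: "e \<gamma> = mv_monom \<gamma> (x e) * B e e" if e: "e \<in> E" and "mdeg \<gamma> \<le> n" for e \<gamma>
    using that(2)
  proof (induction \<gamma> rule: exponent_induct)
    case zero
    have "e 0 = B (w 0) e"
      using reproducing[OF V_sub_full, of e 0] e E(1) by auto
    also have "\<dots> = (\<Sum>f\<in>E. if f = e then B e e else 0)"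
      unfolding E(4) B_sum using e E(6) by (intro sum.cong) auto
    also have "\<dots> = B e e"
      using e E(2) by simp
    finally show ?case
      by simp
  next
    case (step \<gamma> i)
    then have "e (\<gamma> + unit_exponent i) = T i e \<gamma>"
      using T_shift[of e \<gamma> i] e E(1) by auto
    then show ?case
      using step by (simp add: T_e[OF e] mv_monom_add)
  qed
  have w_apply: "w \<beta> = (\<Sum>e\<in>E. (\<lambda>\<alpha>. mv_monom \<beta> (x e) * e \<alpha>))" if "mdeg \<beta> \<le> n" "w \<beta> \<in> V n" for \<beta>
    using that
  proof (induction \<beta> rule: exponent_induct)
    case zero
    show "w 0 = (\<Sum>e\<in>E. (\<lambda>\<alpha>. mv_monom 0 (x e) * e \<alpha>))"
      using E(4) by simp
  next
    case (step \<beta> i)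
    have \<beta>: "mdeg \<beta> < n"
      using step.prems by simp
    have "w (\<beta> + unit_exponent i) = T i (w \<beta>)"
      using T_column[OF \<beta> step.prems(2)] by simp
    also have "\<dots> = (\<Sum>e\<in>E. T i (\<lambda>\<alpha>. mv_monom \<beta> (x e) * e \<alpha>))"
    proof -
      have "w \<beta> = (\<Sum>e\<in>E. (\<lambda>\<alpha>. mv_monom \<beta> (x e) * e \<alpha>))"
        using \<beta> by (intro step.IH moment_column_in) auto
      then have "T i (w \<beta>) = T i (\<Sum>e\<in>E. (\<lambda>\<alpha>. mv_monom \<beta> (x e) * e \<alpha>))"
        by (rule arg_cong)
      then show ?thesis
        unfolding T_sum .
    qed
    also have "\<dots> = (\<Sum>e\<in>E. (\<lambda>\<alpha>. mv_monom (\<beta> + unit_exponent i) (x e) * e \<alpha>))"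
    proof (rule sum.cong[OF refl])
      fix e assume "e \<in> E"
      show "T i (\<lambda>\<alpha>. mv_monom \<beta> (x e) * e \<alpha>) =
          (\<lambda>\<alpha>. mv_monom (\<beta> + unit_exponent i) (x e) * e \<alpha>)"
        using T_scale[of i "mv_monom \<beta> (x e)" e] T_e[OF \<open>e \<in> E\<close>, of i]
        by (simp only: mv_monom_add mv_monom_unit_exponent mult.assoc)
    qed
    finally show ?case .
  qed
  have rep: "\<phi> (\<beta> + \<gamma>) = (\<Sum>e\<in>E. mv_monom (\<beta> + \<gamma>) (x e) * B e e)"
    if "mdeg \<beta> \<le> n" "w \<beta> \<in> V n" "mdeg \<gamma> \<le> n" for \<beta> \<gamma>
  proof -
    have "\<phi> (\<beta> + \<gamma>) = w \<beta> \<gamma>"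
      using that by (simp add: moment_column_def add.commute)
    also have "\<dots> = (\<Sum>e\<in>E. mv_monom \<beta> (x e) * e \<gamma>)"
      unfolding w_apply[OF that(1,2)] sum_fun_apply ..
    also have "\<dots> = (\<Sum>e\<in>E. mv_monom (\<beta> + \<gamma>) (x e) * B e e)"
      using e_apply that(3) by (intro sum.cong) (auto simp: mv_monom_add)
    finally show ?thesis .
  qed
  show thesis
    by (rule that[OF E(2,1,3) pos E(6) e_apply rep])
qed

text \<open>An atom's eigenvector \<open>e\<close> is the class of a polynomial of degree less than \<open>k\<close> that
  takes the value 1 at the atom \<open>x e\<close> and vanishes at all other atoms.\<close>

lemma localizing_nonneg_at_atom:
  fixes x :: "(nat ^ 'd \<Rightarrow> real) \<Rightarrow> real ^ 'd"
  assumes "finite E" "E \<subseteq> V k" "k \<le> n + 1"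
    and pos: "\<And>e. e \<in> E \<Longrightarrow> B e e > 0"
    and orth: "\<And>e f. e \<in> E \<Longrightarrow> f \<in> E \<Longrightarrow> e \<noteq> f \<Longrightarrow> B e f = 0"
    and app: "\<And>e \<gamma>. e \<in> E \<Longrightarrow> mdeg \<gamma> \<le> n \<Longrightarrow> e \<gamma> = mv_monom \<gamma> (x e) * B e e"
    and rep: "\<And>\<alpha>. mdeg \<alpha> \<le> 2 * (k - 1) + mvpoly_degree g \<Longrightarrow>
        \<phi> \<alpha> = (\<Sum>e\<in>E. mv_monom \<alpha> (x e) * B e e)"
    and psd: "psd_on (exponents_upto l) (localizing_matrix g \<phi>)" and "k \<le> l + 1"
    and "e \<in> E"
  shows "mvpoly_eval g (x e) \<ge> 0"
proof -
  define J where "J = {\<alpha> :: nat ^ 'd. mdeg \<alpha> < k}"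
  have finJ: "finite J"
    by (simp add: J_def)
  obtain L :: "(nat ^ 'd \<Rightarrow> real) \<Rightarrow> nat ^ 'd \<Rightarrow> real" where
    L: "\<And>f a. f \<in> fun_vs.span (w ` J) \<Longrightarrow> f a = (\<Sum>j\<in>J. L f j * w j a)"
    by (rule fun_span_linear_coefficients[OF finJ, of w]) blast
  define p where "p = L e"
  have e_sum: "e = (\<Sum>\<alpha>\<in>J. (\<lambda>\<beta>. p \<alpha> * w \<alpha> \<beta>))"
  proof
    fix \<beta>
    have "e \<in> fun_vs.span (w ` J)"
      using assms(2) \<open>e \<in> E\<close> by (auto simp: column_span_def J_def)
    then show "e \<beta> = (\<Sum>\<alpha>\<in>J. (\<lambda>\<beta>. p \<alpha> * w \<alpha> \<beta>)) \<beta>"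
      unfolding sum_fun_apply p_def by (rule L)
  qed
  define P where "P y = (\<Sum>\<alpha>\<in>J. p \<alpha> * mv_monom \<alpha> y)" for y
  have P: "P (x f) = (if f = e then 1 else 0)" if f: "f \<in> E" for f
  proof -
    have f_full: "f \<in> V (n + 1)"
      using f assms(2) column_span_mono[OF assms(3), of \<phi> n] by blast
    have "B e f = (\<Sum>\<alpha>\<in>J. p \<alpha> * B (w \<alpha>) f)"
      by (subst e_sum) (simp add: B_sum B_scale)
    also have "\<dots> = (\<Sum>\<alpha>\<in>J. p \<alpha> * mv_monom \<alpha> (x f) * B f f)"
      using reproducing[OF f_full] app[OF f] assms(3) by (intro sum.cong) (auto simp: J_def)
    also have "\<dots> = P (x f) * B f f"
      by (simp add: P_def sum_distrib_right)
    finally show ?thesis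
      using orth[OF \<open>e \<in> E\<close> f] pos[OF f] by auto
  qed
  have loc: "localizing_matrix g \<phi> \<alpha> \<beta> =
      (\<Sum>f\<in>E. mv_monom \<alpha> (x f) * mv_monom \<beta> (x f) * (mvpoly_eval g (x f) * B f f))"
    if "\<alpha> \<in> J" "\<beta> \<in> J" for \<alpha> \<beta>
  proof -
    have "localizing_matrix g \<phi> \<alpha> \<beta> = (\<Sum>\<gamma>\<in>Poly_Mapping.keys g. \<Sum>f\<in>E.
        Poly_Mapping.lookup g \<gamma> * (mv_monom (\<alpha> + \<beta> + \<gamma>) (x f) * B f f))"
      unfolding localizing_matrix_def
    proof (intro sum.cong refl)
      fix \<gamma> assume "\<gamma> \<in> Poly_Mapping.keys g"
      then have "mdeg \<gamma> \<le> mvpoly_degree g"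
        unfolding mvpoly_degree_def by (intro Max_ge) auto
      then have "mdeg (\<alpha> + \<beta> + \<gamma>) \<le> 2 * (k - 1) + mvpoly_degree g"
        using that by (auto simp: J_def)
      from rep[OF this]
      show "Poly_Mapping.lookup g \<gamma> * \<phi> (\<alpha> + \<beta> + \<gamma>) = (\<Sum>f\<in>E.
          Poly_Mapping.lookup g \<gamma> * (mv_monom (\<alpha> + \<beta> + \<gamma>) (x f) * B f f))"
        by (simp add: sum_distrib_left)
    qed
    also have "\<dots> = (\<Sum>f\<in>E. \<Sum>\<gamma>\<in>Poly_Mapping.keys g.
        Poly_Mapping.lookup g \<gamma> * (mv_monom (\<alpha> + \<beta> + \<gamma>) (x f) * B f f))"
      by (rule sum.swap)
    also have "\<dots> = (\<Sum>f\<in>E. mv_monom \<alpha> (x f) * mv_monom \<beta> (x f) * (mvpoly_eval g (x f) * B f f))"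
      unfolding mvpoly_eval_def sum_distrib_left sum_distrib_right
      by (intro sum.cong refl) (simp add: mv_monom_add)
    finally show ?thesis .
  qed
  \<comment> \<open>Testing semidefiniteness on the coefficients of the separating polynomial,
    padded with zeros, leaves only the term of the atom \<open>x e\<close>.\<close>
  define u where "u \<alpha> = (if \<alpha> \<in> J then p \<alpha> else 0)" for \<alpha>
  have J_sub: "J \<subseteq> exponents_upto l"
    using \<open>k \<le> l + 1\<close> by (auto simp: J_def exponents_upto_def)
  have "0 \<le> (\<Sum>\<alpha>\<in>exponents_upto l. \<Sum>\<beta>\<in>exponents_upto l. u \<alpha> * localizing_matrix g \<phi> \<alpha> \<beta> * u \<beta>)"
    using psd by (simp add: psd_on_def)
  also have "\<dots> = (\<Sum>\<alpha>\<in>J. \<Sum>\<beta>\<in>exponents_upto l. u \<alpha> * localizing_matrix g \<phi> \<alpha> \<beta> * u \<beta>)"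
    using J_sub finite_exponents_upto by (intro sum.mono_neutral_right) (auto simp: u_def)
  also have "\<dots> = (\<Sum>\<alpha>\<in>J. \<Sum>\<beta>\<in>J. u \<alpha> * localizing_matrix g \<phi> \<alpha> \<beta> * u \<beta>)"
    using J_sub finite_exponents_upto
    by (intro sum.cong[OF refl] sum.mono_neutral_right) (auto simp: u_def)
  also have "\<dots> = (\<Sum>\<alpha>\<in>J. \<Sum>\<beta>\<in>J. \<Sum>f\<in>E. (p \<alpha> * mv_monom \<alpha> (x f)) * (p \<beta> * mv_monom \<beta> (x f)) *
      (mvpoly_eval g (x f) * B f f))"
    by (intro sum.cong refl) (simp add: u_def loc sum_distrib_left sum_distrib_right mult_ac)
  also have "\<dots> = (\<Sum>f\<in>E. \<Sum>\<alpha>\<in>J. \<Sum>\<beta>\<in>J. (p \<alpha> * mv_monom \<alpha> (x f)) * (p \<beta> * mv_monom \<beta> (x f)) *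
      (mvpoly_eval g (x f) * B f f))"
    by (subst sum.swap[of _ E], subst sum.swap[of _ E]) (rule refl)
  also have "\<dots> = (\<Sum>f\<in>E. P (x f) * P (x f) * (mvpoly_eval g (x f) * B f f))"
    unfolding P_def sum_product unfolding sum_distrib_right ..
  also have "\<dots> = (\<Sum>f\<in>E. if f = e then mvpoly_eval g (x e) * B e e else 0)"
    by (intro sum.cong) (auto simp: P)
  also have "\<dots> = mvpoly_eval g (x e) * B e e"
    using \<open>e \<in> E\<close> assms(1) by simp
  finally show ?thesis
    using pos[OF \<open>e \<in> E\<close>] by (simp add: zero_le_mult_iff)
qed

section \<open>Dimension count along the filtration\<close>

lemma dim_V_0: "V 0 \<subset> V 1" if "\<phi> 0 = 1"
proof -
  have "w 0 \<in> V 1"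
    by (intro moment_column_in) simp
  moreover have "w 0 \<notin> V 0"
  proof
    assume "w 0 \<in> V 0"
    then have "w 0 = 0"
      by (simp add: column_span_def)
    then have "w 0 0 = 0"
      by simp
    then show False
      using that by (simp add: moment_column_def)
  qed
  ultimately show ?thesis
    using column_span_mono[of 0 1 \<phi> n] by auto
qed

text \<open>The two alternatives are what exactness up to degree \<open>2 n\<close> and up to
  \<open>2 n - 1\<close>, respectively, permit when the constraints are tested. A stall at
  \<open>k \<le> n - v\<close> below \<open>n\<close> gives the second. Otherwise
  \<open>dim (V j) \<ge> j\<close> up to \<open>n - v + 1\<close>, capped at \<open>n\<close>; for
  \<open>v > 0\<close> the rank bound then forces \<open>V (n - v + 1)\<close> to be everything, and
  for \<open>v = 0\<close> a missing last column leaves \<open>dim (V n) \<le> n\<close>.\<close>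

lemma stable_degree_exists:
  assumes "\<phi> 0 = 1" "n > 0" "v \<le> n" and rank: "dim (V (n + 1)) \<le> n - v + 1"
  obtains k where "0 < k" "k \<le> n" "V k = V n"
    "(V (n + 1) = V n \<and> k + v \<le> n + 1) \<or> (k + v \<le> n \<and> dim (V n) \<le> dim (V (n - 1)) + 1)"
proof (cases "\<exists>k<n. k + v \<le> n \<and> V (k + 1) = V k")
  case True
  then obtain k where k: "k < n" "k + v \<le> n" "V (k + 1) = V k"
    by blast
  have "V n = V k" "V (n - 1) = V k"
    using k column_span_stable[OF k(3), of n] column_span_stable[OF k(3), of "n - 1"] by auto
  moreover have "k > 0"
    using k(3) dim_V_0[OF assms(1)] by (cases k) auto
  ultimately show thesis
    using that[of k] k by simp
next
  case False
  have lower: "j \<le> dim (V j)" if "j \<le> n" "j + v \<le> n + 1" for j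
    using that
  proof (induction j)
    case 0
    then show ?case by simp
  next
    case (Suc j)
    have "V j \<subset> V (Suc j)"
      using False Suc.prems column_span_mono[of j "Suc j" \<phi> n] by auto
    then show ?case
      using dim_V_strict_mono[of j "Suc j"] Suc by simp
  qed
  show thesis
  proof (cases "v = 0")
    case True
    show thesis
    proof (cases "V (n + 1) = V n")
      case T: True
      then show thesis
        using that[of n] True \<open>n > 0\<close> by simp
    next
      case F: False
      then have "V n \<subset> V (n + 1)"
        using column_span_mono[of n "n + 1" \<phi> n] by auto
      then have "dim (V n) \<le> n"
        using dim_V_strict_mono[of n "n + 1"] rank by simp
      moreover have "n - 1 \<le> dim (V (n - 1))"
        using lower[of "n - 1"] True by simp
      ultimately have "dim (V n) \<le> dim (V (n - 1)) + 1"
        by linarith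
      then show thesis
        using that[of n] True \<open>n > 0\<close> by simp
    qed
  next
    case v: False
    define k where "k = n - v + 1"
    have k: "0 < k" "k \<le> n" "k + v = n + 1"
      using v assms(3) by (auto simp: k_def)
    have sub: "V k \<subseteq> V n" "V n \<subseteq> V (n + 1)"
      using k by (auto intro!: column_span_mono)
    have "V k = V (n + 1)"
    proof (rule ccontr)
      assume "V k \<noteq> V (n + 1)"
      then have "dim (V k) < dim (V (n + 1))"
        using sub by (intro dim_V_strict_mono) auto
      then show False
        using lower[of k] k rank by (simp add: k_def)
    qed
    then have "V k = V n" "V (n + 1) = V n"
      using sub by auto
    then show thesis
      using that[of k] k by simp
  qed
qed

end

section \<open>The representing measure\<close>

lemma finitely_atomic_measure:
  fixes x :: "'a \<Rightarrow> real ^ 'd::finite"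
  assumes "finite E" "\<And>e. e \<in> E \<Longrightarrow> m e > 0" "x ` E \<subseteq> K"
    and rep: "\<And>\<alpha>. \<alpha> \<in> A \<Longrightarrow> \<phi> \<alpha> = (\<Sum>e\<in>E. mv_monom \<alpha> (x e) * m e)"
  shows "\<exists>\<mu>. representing_measure A \<phi> \<mu> \<and> supported_on_points \<mu> (card (x ` E)) K"
proof -
  define N where "N = point_measure E (\<lambda>e. ennreal (m e))"
  \<comment> \<open>Should atoms coincide, the push-forward adds their masses; hence the support is
    counted by the image of \<open>E\<close> under \<open>x\<close>.\<close>
  define \<mu> where "\<mu> = distr N borel x"
  have x_meas: "x \<in> measurable N borel"
    by (simp add: N_def)
  have mono_meas: "mv_monom \<alpha> \<in> borel_measurable borel" for \<alpha> :: "nat ^ 'd"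
    unfolding mv_monom_def by measurable
  have "representing_measure A \<phi> \<mu>"
    unfolding representing_measure_def
  proof (intro conjI ballI)
    show "sets \<mu> = sets borel"
      by (simp add: \<mu>_def)
    fix \<alpha> assume "\<alpha> \<in> A"
    have "integrable N (\<lambda>e. mv_monom \<alpha> (x e))"
      unfolding N_def using assms(1) by (intro integrable_point_measure_finite)
    then show "integrable \<mu> (mv_monom \<alpha>)"
      unfolding \<mu>_def by (subst integrable_distr_eq[OF x_meas mono_meas])
    have "integral\<^sup>L \<mu> (mv_monom \<alpha>) = integral\<^sup>L N (\<lambda>e. mv_monom \<alpha> (x e))"
      unfolding \<mu>_def by (rule integral_distr[OF x_meas mono_meas])
    also have "\<dots> = (\<Sum>e\<in>E. m e *\<^sub>R mv_monom \<alpha> (x e))"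
      unfolding N_def using assms(1,2) by (intro lebesgue_integral_point_measure_finite) (auto intro: less_imp_le)
    finally show "\<phi> \<alpha> = integral\<^sup>L \<mu> (mv_monom \<alpha>)"
      using rep[OF \<open>\<alpha> \<in> A\<close>] by (simp add: mult.commute)
  qed
  moreover have "emeasure \<mu> (- (x ` E)) = 0"
  proof -
    have "x -` (- (x ` E)) \<inter> space N = {}"
      by (auto simp: N_def space_point_measure)
    moreover have "- (x ` E) \<in> sets borel"
      using assms(1) by (intro borel_open open_Compl finite_imp_closed) auto
    ultimately show ?thesis
      unfolding \<mu>_def by (simp add: emeasure_distr[OF x_meas])
  qed
  moreover have "emeasure \<mu> {x e} > 0" if "e \<in> E" for e
  proof -
    have "0 < emeasure N {e}"
      unfolding N_def using that assms(1,2) by (subst emeasure_point_measure_finite) auto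
    also have "\<dots> \<le> emeasure N (x -` {x e} \<inter> space N)"
      using that by (intro emeasure_mono) (auto simp: N_def space_point_measure sets_point_measure)
    also have "\<dots> = emeasure \<mu> {x e}"
      unfolding \<mu>_def by (subst emeasure_distr[OF x_meas]) auto
    finally show ?thesis .
  qed
  ultimately show ?thesis
    unfolding supported_on_points_def using assms(1,3) by (intro exI[of _ \<mu>] conjI exI[of _ "x ` E"]) auto
qed

theorem theorem1:
  fixes g :: "nat \<Rightarrow> 'd::finite mvpoly"
    and m n v s :: nat
    and dg :: "nat \<Rightarrow> nat"
    and K :: "(real ^ 'd) set"
    and \<phi> :: "nat ^ 'd \<Rightarrow> real"
  assumes "m \<ge> 1"
    and K_eq: "K = {x. \<forall>j\<in>{1..m}. mvpoly_eval (g j) x \<ge> 0}"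
    and dg_eq: "\<And>j. j \<in> {1..m} \<Longrightarrow> dg j = nat \<lceil>real (mvpoly_degree (g j)) / 2\<rceil>"
    and v_eq: "v = Max (dg ` {1..m})"
    and "n \<ge> v"
    and "riesz \<phi> 1 = 1"
    and "psd_on (exponents_upto n) (moment_matrix \<phi>)"
    and "\<And>j. j \<in> {1..m} \<Longrightarrow>
           psd_on (exponents_upto (n - dg j)) (localizing_matrix (g j) \<phi>)"
    and s_eq: "s = rank_on (exponents_upto n) (moment_matrix \<phi>)"
    and "s \<le> n - v + 1"
  shows "\<exists>r\<le>s.
           (\<exists>\<mu>. representing_measure {\<alpha>. mdeg \<alpha> < 2 * n} \<phi> \<mu> \<and> supported_on_points \<mu> r K) \<and>
           (r = s \<longrightarrow>
             (\<exists>\<mu>. representing_measure (exponents_upto (2 * n)) \<phi> \<mu> \<and> supported_on_points \<mu> s K))"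
proof -
  obtain B where B: "psd_form (\<lambda>c f i. c * f i) B"
    "\<And>\<alpha> h. h \<in> column_span \<phi> n (n + 1) \<Longrightarrow> mdeg \<alpha> \<le> n \<Longrightarrow> B (moment_column \<phi> n \<alpha>) h = h \<alpha>"
    by (rule reproducing_form_exists[OF assms(7)]) blast
  obtain T where T: "\<And>i. Vector_Spaces.linear (\<lambda>c f i. c * f i) (\<lambda>c f i. c * f i) (T i)"
    "\<And>i f. T i f \<in> column_span \<phi> n n"
    "\<And>i f \<beta>. f \<in> column_span \<phi> n n \<Longrightarrow> mdeg \<beta> < n \<Longrightarrow> T i f \<beta> = f (\<beta> + unit_exponent i)"
    using shift_operator_exists[OF assms(7)] by metis
  interpret psd_form "\<lambda>(c :: real) (f :: nat ^ 'd \<Rightarrow> real) i. c * f i" B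
    by (rule B(1))
  interpret moment_operators B \<phi> n T
    by (intro moment_operators.intro B(1) moment_operators_axioms.intro B(2) T)
  have \<phi>0: "\<phi> 0 = 1"
    using assms(6) by (simp add: riesz_def)
  have "moment_column \<phi> n ` {\<alpha>. mdeg \<alpha> < n + 1} =
      (\<lambda>j i. if i \<in> exponents_upto n then moment_matrix \<phi> i j else 0) ` exponents_upto n"
    by (intro image_cong) (auto simp: exponents_upto_def moment_column_def moment_matrix_def fun_eq_iff)
  then have s_dim: "s = fun_vs.dim (V (n + 1))"
    unfolding s_eq rank_on_def column_span_def by simp
  show ?thesis
  proof (cases "n = 0")
    \<comment> \<open>There is no moment of degree less than 0, so the zero measure with
      \<open>r = 0\<close> does; \<open>s > 0\<close> makes the second claim vacuous.\<close>
    case True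
    have "s > 0"
      using dim_V_strict_mono[OF dim_V_0[OF \<phi>0]] True s_dim by simp
    moreover have "representing_measure {\<alpha>. mdeg \<alpha> < 2 * n} \<phi> (null_measure borel)"
      using True by (simp add: representing_measure_def)
    moreover have "supported_on_points (null_measure borel) 0 K"
      unfolding supported_on_points_def by (intro exI[of _ "{}"]) simp
    ultimately show ?thesis
      by (intro exI[of _ 0]) auto
  next
    case False
    then have "n > 0"
      by simp
    obtain k where k: "k \<le> n" "V k = V n"
      "(V (n + 1) = V n \<and> k + v \<le> n + 1) \<or>
        (k + v \<le> n \<and> fun_vs.dim (V n) \<le> fun_vs.dim (V (n - 1)) + 1)"
      and "0 < k"
      using stable_degree_exists[OF \<phi>0 \<open>n > 0\<close> \<open>n \<ge> v\<close>] assms(10) s_dim by metis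
    have comm: "V (n + 1) = V n \<or> fun_vs.dim (V n) \<le> fun_vs.dim (V (n - 1)) + 1"
      using k(3) by blast
    obtain E and x :: "(nat ^ 'd \<Rightarrow> real) \<Rightarrow> real ^ 'd" where E:
      "finite E" "E \<subseteq> V n" "card E \<le> fun_vs.dim (V n)"
      "\<And>e. e \<in> E \<Longrightarrow> B e e > 0" "\<And>e f. e \<in> E \<Longrightarrow> f \<in> E \<Longrightarrow> e \<noteq> f \<Longrightarrow> B e f = 0"
      "\<And>e \<gamma>. e \<in> E \<Longrightarrow> mdeg \<gamma> \<le> n \<Longrightarrow> e \<gamma> = mv_monom \<gamma> (x e) * B e e"
      "\<And>\<beta> \<gamma>. mdeg \<beta> \<le> n \<Longrightarrow> w \<beta> \<in> V n \<Longrightarrow> mdeg \<gamma> \<le> n \<Longrightarrow>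
        \<phi> (\<beta> + \<gamma>) = (\<Sum>e\<in>E. mv_monom (\<beta> + \<gamma>) (x e) * B e e)"
      by (rule atoms_exist[OF \<open>n > 0\<close> comm]) blast
    have rep: "\<phi> \<alpha> = (\<Sum>e\<in>E. mv_monom \<alpha> (x e) * B e e)" if \<alpha>: "mdeg \<alpha> < 2 * n" for \<alpha>
    proof -
      \<comment> \<open>Columns of degree at most \<open>n - 1\<close> always lie in
        \<open>V n\<close>, and rows reach degree \<open>n\<close>: this is the origin of the
        exactness degree \<open>2 n - 1\<close>.\<close>
      have "mdeg \<alpha> \<le> (n - 1) + n"
        using \<alpha> by simp
      then obtain \<beta> \<gamma> where \<beta>\<gamma>: "\<alpha> = \<beta> + \<gamma>" "mdeg \<beta> \<le> n - 1" "mdeg \<gamma> \<le> n"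
        by (rule mdeg_split)
      then have "w \<beta> \<in> V n"
        using \<open>n > 0\<close> by (intro moment_column_in) simp
      then show ?thesis
        using E(7) \<beta>\<gamma> by simp
    qed
    have rep_full: "\<phi> \<alpha> = (\<Sum>e\<in>E. mv_monom \<alpha> (x e) * B e e)"
      if "V (n + 1) = V n" and \<alpha>: "mdeg \<alpha> \<le> 2 * n" for \<alpha>
    proof -
      have "mdeg \<alpha> \<le> n + n"
        using \<alpha> by simp
      then obtain \<beta> \<gamma> where \<beta>\<gamma>: "\<alpha> = \<beta> + \<gamma>" "mdeg \<beta> \<le> n" "mdeg \<gamma> \<le> n"
        by (rule mdeg_split)
      then have "w \<beta> \<in> V n"
        unfolding that(1)[symmetric] by (intro moment_column_in) simp
      then show ?thesis
        using E(7) \<beta>\<gamma> by simp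
    qed
    have "mvpoly_eval (g j) (x e) \<ge> 0" if e: "e \<in> E" and j: "j \<in> {1..m}" for e j
    proof (rule localizing_nonneg_at_atom[OF E(1) _ _ E(4-6) _ assms(8)[OF j] _ e])
      have deg: "mvpoly_degree (g j) \<le> 2 * dg j"
        unfolding dg_eq[OF j] by linarith
      have dg_le: "dg j \<le> v"
        unfolding v_eq using j by (intro Max_ge) auto
      show "E \<subseteq> V k"
        using E(2) k(2) by simp
      show "k \<le> n + 1" "k \<le> n - dg j + 1"
        using k dg_le by auto
      fix \<alpha> :: "nat ^ 'd"
      assume \<alpha>: "mdeg \<alpha> \<le> 2 * (k - 1) + mvpoly_degree (g j)"
      show "\<phi> \<alpha> = (\<Sum>e\<in>E. mv_monom \<alpha> (x e) * B e e)"
      \<comment> \<open>The degree is at most \<open>2 * (k + v) - 2\<close>: at most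
        \<open>2 n\<close> if \<open>k + v \<le> n + 1\<close>, where full exactness holds, and at
        most \<open>2 n - 2\<close> if \<open>k + v \<le> n\<close>.\<close>
      proof (cases "V (n + 1) = V n")
        case True
        have "k + v \<le> n + 1"
          using k(3) by linarith
        then show ?thesis
          using \<alpha> deg dg_le \<open>0 < k\<close> by (intro rep_full[OF True]) simp
      next
        case False
        then have "k + v \<le> n"
          using k(3) by blast
        then show ?thesis
          using \<alpha> deg dg_le \<open>0 < k\<close> by (intro rep) simp
      qed
    qed
    then have xK: "x ` E \<subseteq> K"
      by (auto simp: K_eq)
    have V_sub: "V n \<subseteq> V (n + 1)"
      by (rule column_span_mono) simp
    have dim_le: "fun_vs.dim (V n) \<le> s"
      using dim_V_strict_mono[of n "n + 1"] V_sub s_dim by (cases "V n = V (n + 1)") (auto simp: psubset_eq)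
    have card_le: "card (x ` E) \<le> card E"
      using E(1) by (rule card_image_le)
    show ?thesis
    proof (intro exI[of _ "card (x ` E)"] conjI impI)
      show "card (x ` E) \<le> s"
        using card_le E(3) dim_le by simp
      show "\<exists>\<mu>. representing_measure {\<alpha>. mdeg \<alpha> < 2 * n} \<phi> \<mu> \<and> supported_on_points \<mu> (card (x ` E)) K"
        using rep by (intro finitely_atomic_measure[OF E(1,4) xK]) auto
    next
      assume r: "card (x ` E) = s"
      \<comment> \<open>There are at most as many atoms as the dimension of \<open>V n\<close>, so
        \<open>s\<close> distinct atoms leave no dimension for a column outside
        \<open>V n\<close>.\<close>
      have full: "V (n + 1) = V n"
      proof (rule ccontr)
        assume "V (n + 1) \<noteq> V n"
        then have "fun_vs.dim (V n) < s"
          unfolding s_dim using V_sub by (intro dim_V_strict_mono) auto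
        then show False
          using r card_le E(3) by simp
      qed
      have "\<exists>\<mu>. representing_measure (exponents_upto (2 * n)) \<phi> \<mu> \<and> supported_on_points \<mu> (card (x ` E)) K"
        using rep_full[OF full] by (intro finitely_atomic_measure[OF E(1,4) xK]) (auto simp: exponents_upto_def)
      then show "\<exists>\<mu>. representing_measure (exponents_upto (2 * n)) \<phi> \<mu> \<and> supported_on_points \<mu> s K"
        unfolding r .
    qed
  qed
qed

end
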